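(* Let $G$ be a finite group, let $L(G)$ be the lattice of normal subgroups of $G$, let $\mu$ be the Möbius function of $L(G)$, and let $H\le T$ be normal subgroups of $G$. Let $S$ denote the socle of $G/H$. (a) $\mu(H,T)=0$ unless $T/H$ is contained in $S$. (b) Let $A_1,\dots,A_a$ be representatives of the $G/H$-isomorphism classes of elementary Abelian minimal normal subgroups of $G/H$, let $S_{a+1},\dots,S_{a+b}$ be the non-Abelian minimal normal subgroups of $G/H$, and write $S\cong\prod_{i=1}^{a}A_i^{d_i}\times\prod_{j=a+1}^{a+b}S_j$, where $A_i^{d_i}$ is the subgroup generated by all minimal normal subgroups of $G/H$ that are $G/H$-isomorphic to $A_i$. Put $q_i=|\mathrm{Hom}_{G/H}(A_i,A_i)|$. If $T/H\le S$ and $T/H\cong\prod_{i=1}^{a}A_i^{\alpha_i}\times\prod_{k=1}^{c}S_{j_k}$ (as groups with $G/H$-action by conjugation, the $j_k$ being distinct indices in $\{a+1,\dots,a+b\}$ and the $S_{j_k}$ being the non-Abelian minimal normal subgroups of $G/H$ contained in $T/H$), then $$\mu(H,T)=(-1)^c\prod_{i=1}^{a}(-1)^{\alpha_i}q_i^{\binom{\alpha_i}{2}}.$$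
   Context: All groups are finite. $L(G)$ is the set of normal subgroups of $G$ ordered by inclusion (meet is intersection, join is product). The Möbius function of a finite poset is defined by $\mu(x,x)=1$ and $\sum_{x\le z\le y}\mu(x,z)=0$ for $x<y$. The socle of a group is the subgroup generated by all its minimal normal subgroups. For a group $\Gamma$, an elementary Abelian minimal normal subgroup of $\Gamma$ is viewed as a simple $\Gamma$-module, $\Gamma$ acting by conjugation. Two such subgroups $M,M'$ are $\Gamma$-isomorphic if there is a group isomorphism $f:M\to M'$ with $f(x^g)=f(x)^g$ for all $g\in\Gamma$. $\mathrm{Hom}_\Gamma(A,A)$ is the set of group homomorphisms $A\to A$ commuting with the conjugation action of $\Gamma$. $A_i^{d}$ denotes the direct product of $d$ copies of $A_i$. Empty products are trivial (equal to $1$). *)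

theory Defs
  imports
    "HOL-Algebra.Order"
    "HOL-Algebra.Product_Groups"
    "HOL-Computational_Algebra.Primes"
begin

section \<open>The Moebius function of a finite poset\<close>

text \<open>
  Outside its domain (an infinite or ill-formed poset, elements not in the carrier, or
  incomparable elements) the function takes the value \<open>0\<close>.  The lemmas \<open>mobius_refl\<close> and
  \<open>mobius_sum\<close> are the usual defining equations.
\<close>

function mobius :: "('a, 'm) gorder_scheme \<Rightarrow> 'a \<Rightarrow> 'a \<Rightarrow> int" where
  "mobius L x y =
     (if partial_order L \<and> finite (carrier L) \<and> x \<in> carrier L \<and> y \<in> carrier L
      then if x = y then 1
           else if x \<sqsubset>\<^bsub>L\<^esub> y
           then - (\<Sum>z\<in>{z \<in> carrier L. x \<sqsubseteq>\<^bsub>L\<^esub> z \<and> z \<sqsubset>\<^bsub>L\<^esub> y}. mobius L x z)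
           else 0
      else 0)"
  by pat_completeness auto
termination
proof (relation "measure (\<lambda>(L, x, y). card {w \<in> carrier L. w \<sqsubset>\<^bsub>L\<^esub> y})")
  fix L :: "('a, 'm) gorder_scheme" and x y z
  assume L: "partial_order L \<and> finite (carrier L) \<and> x \<in> carrier L \<and> y \<in> carrier L"
    and z: "z \<in> {z \<in> carrier L. x \<sqsubseteq>\<^bsub>L\<^esub> z \<and> z \<sqsubset>\<^bsub>L\<^esub> y}"
  interpret partial_order L using L by simp
  have "{w \<in> carrier L. w \<sqsubset>\<^bsub>L\<^esub> z} \<subset> {w \<in> carrier L. w \<sqsubset>\<^bsub>L\<^esub> y}"
  proof
    show "{w \<in> carrier L. w \<sqsubset>\<^bsub>L\<^esub> z} \<subseteq> {w \<in> carrier L. w \<sqsubset>\<^bsub>L\<^esub> y}"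
      using L z by (auto intro: lless_trans)
    show "{w \<in> carrier L. w \<sqsubset>\<^bsub>L\<^esub> z} \<noteq> {w \<in> carrier L. w \<sqsubset>\<^bsub>L\<^esub> y}"
      using z by (auto simp: lless_eq)
  qed
  then show "((L, x, z), L, x, y) \<in> measure (\<lambda>(L, x, y). card {w \<in> carrier L. w \<sqsubset>\<^bsub>L\<^esub> y})"
    using L by (auto intro!: psubset_card_mono)
qed auto

declare mobius.simps [simp del]

lemma mobius_refl:
  assumes "partial_order L" "finite (carrier L)" "x \<in> carrier L"
  shows "mobius L x x = 1"
  using assms by (simp add: mobius.simps)

lemma mobius_sum:
  assumes "partial_order L" "finite (carrier L)" "x \<in> carrier L" "y \<in> carrier L" "x \<sqsubset>\<^bsub>L\<^esub> y"
  shows "(\<Sum>z\<in>{z \<in> carrier L. x \<sqsubseteq>\<^bsub>L\<^esub> z \<and> z \<sqsubseteq>\<^bsub>L\<^esub> y}. mobius L x z) = 0"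
proof -
  interpret partial_order L by fact
  let ?B = "{z \<in> carrier L. x \<sqsubseteq>\<^bsub>L\<^esub> z \<and> z \<sqsubset>\<^bsub>L\<^esub> y}"
  have "{z \<in> carrier L. x \<sqsubseteq>\<^bsub>L\<^esub> z \<and> z \<sqsubseteq>\<^bsub>L\<^esub> y} = insert y ?B" "y \<notin> ?B" "finite ?B"
    using assms by (auto simp: lless_eq)
  moreover have "mobius L x y = - (\<Sum>z\<in>?B. mobius L x z)"
    using assms by (subst mobius.simps) (auto simp: lless_eq)
  ultimately show ?thesis by simp
qed


section \<open>The lattice of normal subgroups\<close>

definition normal_lattice :: "('g, 'm) monoid_scheme \<Rightarrow> 'g set gorder" where
  "normal_lattice G = \<lparr>carrier = {N. N \<lhd> G}, eq = (=), le = (\<subseteq>)\<rparr>"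

lemma normal_lattice_simps [simp]:
  "carrier (normal_lattice G) = {N. N \<lhd> G}"
  "N \<sqsubseteq>\<^bsub>normal_lattice G\<^esub> K \<longleftrightarrow> N \<subseteq> K"
  "N .=\<^bsub>normal_lattice G\<^esub> K \<longleftrightarrow> N = K"
  by (auto simp: normal_lattice_def)

lemma normal_lattice_partial_order: "partial_order (normal_lattice G)"
  by unfold_locales (auto simp: normal_lattice_def)

lemma normal_lattice_finite:
  assumes "finite (carrier G)"
  shows "finite (carrier (normal_lattice G))"
  by (rule finite_subset[of _ "Pow (carrier G)"])
     (use assms in \<open>auto dest: normal_imp_subgroup subgroup.subset\<close>)


section \<open>Minimal normal subgroups and the socle\<close>

definition minimal_normal :: "('g, 'm) monoid_scheme \<Rightarrow> 'g set \<Rightarrow> bool" where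
  "minimal_normal G N \<longleftrightarrow>
     N \<lhd> G \<and> N \<noteq> {\<one>\<^bsub>G\<^esub>} \<and> (\<forall>K. K \<lhd> G \<and> K \<subseteq> N \<longrightarrow> K = {\<one>\<^bsub>G\<^esub>} \<or> K = N)"

definition socle :: "('g, 'm) monoid_scheme \<Rightarrow> 'g set" where
  "socle G = generate G (\<Union>{N. minimal_normal G N})"

definition elementary_abelian :: "('g, 'm) monoid_scheme \<Rightarrow> bool" where
  "elementary_abelian A \<longleftrightarrow>
     comm_group A \<and> (\<exists>p::nat. prime p \<and> (\<forall>x\<in>carrier A. x [^]\<^bsub>A\<^esub> p = \<one>\<^bsub>A\<^esub>))"

definition abelian_minimal_normals :: "('g, 'm) monoid_scheme \<Rightarrow> 'g set set" where
  "abelian_minimal_normals G = {N. minimal_normal G N \<and> elementary_abelian (G\<lparr>carrier := N\<rparr>)}"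

definition nonabelian_minimal_normals :: "('g, 'm) monoid_scheme \<Rightarrow> 'g set set" where
  "nonabelian_minimal_normals G = {N. minimal_normal G N \<and> \<not> comm_group (G\<lparr>carrier := N\<rparr>)}"


section \<open>Groups with an action of a fixed group\<close>

text \<open>The conjugate \<open>x\<^sup>g = g\<inverse> x g\<close>, with the acting element as first argument.\<close>

definition conj_act :: "('g, 'm) monoid_scheme \<Rightarrow> 'g \<Rightarrow> 'g \<Rightarrow> 'g" where
  "conj_act G g x = inv\<^bsub>G\<^esub> g \<otimes>\<^bsub>G\<^esub> x \<otimes>\<^bsub>G\<^esub> g"

text \<open>
  Isomorphism of groups \<open>X\<close> and \<open>Y\<close> on which \<open>G\<close> acts by \<open>r\<close> and \<open>s\<close>, respectively.
\<close>

definition equivariant_iso ::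
  "('g, 'm) monoid_scheme \<Rightarrow> ('x, 'n) monoid_scheme \<Rightarrow> ('g \<Rightarrow> 'x \<Rightarrow> 'x)
     \<Rightarrow> ('y, 'k) monoid_scheme \<Rightarrow> ('g \<Rightarrow> 'y \<Rightarrow> 'y) \<Rightarrow> bool" where
  "equivariant_iso G X r Y s \<longleftrightarrow>
     (\<exists>f\<in>iso X Y. \<forall>g\<in>carrier G. \<forall>x\<in>carrier X. f (r g x) = s g (f x))"

definition subgroups_iso :: "('g, 'm) monoid_scheme \<Rightarrow> 'g set \<Rightarrow> 'g set \<Rightarrow> bool" where
  "subgroups_iso G M N \<longleftrightarrow>
     equivariant_iso G (G\<lparr>carrier := M\<rparr>) (conj_act G) (G\<lparr>carrier := N\<rparr>) (conj_act G)"

text \<open>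
  Endomorphisms are taken extensional on \<open>A\<close>, so that the cardinality of this set counts maps
  \<open>A \<rightarrow> A\<close> and not their arbitrary extensions to the ambient type.
\<close>

definition equivariant_endos :: "('g, 'm) monoid_scheme \<Rightarrow> 'g set \<Rightarrow> ('g \<Rightarrow> 'g) set" where
  "equivariant_endos G A =
     {f \<in> hom (G\<lparr>carrier := A\<rparr>) (G\<lparr>carrier := A\<rparr>) \<inter> extensional A.
        \<forall>g\<in>carrier G. \<forall>x\<in>A. f (conj_act G g x) = conj_act G g (f x)}"

text \<open>The subgroup generated by all minimal normal subgroups isomorphic to \<open>A\<close> under the action.\<close>

definition isotypic :: "('g, 'm) monoid_scheme \<Rightarrow> 'g set \<Rightarrow> 'g set" where
  "isotypic G A = generate G (\<Union>{M. minimal_normal G M \<and> subgroups_iso G M A})"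

text \<open>The direct power \<open>A\<^sup>n\<close>, with conjugation in every coordinate.\<close>

definition power_group :: "('g, 'm) monoid_scheme \<Rightarrow> 'g set \<Rightarrow> nat \<Rightarrow> (nat \<Rightarrow> 'g) monoid" where
  "power_group G A n = product_group {1..n} (\<lambda>_. G\<lparr>carrier := A\<rparr>)"

definition power_act ::
  "('g, 'm) monoid_scheme \<Rightarrow> nat \<Rightarrow> 'g \<Rightarrow> (nat \<Rightarrow> 'g) \<Rightarrow> nat \<Rightarrow> 'g" where
  "power_act G n g u = (\<lambda>l\<in>{1..n}. conj_act G g (u l))"

text \<open>
  The external direct product of the powers \<open>A i\<^sup>n\<^sup>i\<close>, \<open>1 \<le> i \<le> a\<close>, and of the groups \<open>S k\<close>,
  \<open>k \<in> K\<close>, again with conjugation in every coordinate.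
\<close>

definition socle_type ::
  "('g, 'm) monoid_scheme \<Rightarrow> nat \<Rightarrow> (nat \<Rightarrow> 'g set) \<Rightarrow> (nat \<Rightarrow> nat) \<Rightarrow> nat set \<Rightarrow> (nat \<Rightarrow> 'g set)
     \<Rightarrow> ((nat \<Rightarrow> nat \<Rightarrow> 'g) \<times> (nat \<Rightarrow> 'g)) monoid" where
  "socle_type G a A n K S =
     product_group {1..a} (\<lambda>i. power_group G (A i) (n i))
       \<times>\<times> product_group K (\<lambda>k. G\<lparr>carrier := S k\<rparr>)"

definition socle_type_act ::
  "('g, 'm) monoid_scheme \<Rightarrow> nat \<Rightarrow> (nat \<Rightarrow> nat) \<Rightarrow> nat set \<Rightarrow> 'g
     \<Rightarrow> (nat \<Rightarrow> nat \<Rightarrow> 'g) \<times> (nat \<Rightarrow> 'g) \<Rightarrow> (nat \<Rightarrow> nat \<Rightarrow> 'g) \<times> (nat \<Rightarrow> 'g)" where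
  "socle_type_act G a n K g = (\<lambda>(u, v).
     (\<lambda>i\<in>{1..a}. power_act G (n i) g (u i), \<lambda>k\<in>K. conj_act G g (v k)))"

end

theory Submission
  imports Defs "HOL-Algebra.SndIsomorphismGrp" "HOL-Algebra.Multiplicative_Group"
begin

text \<open>
  The interval between \<open>H\<close> and \<open>T\<close> is the interval below \<open>T/H\<close> in the lattice of \<open>G/H\<close>, so one may
  take \<open>H = 1\<close>.  Outside the socle \<open>\<mu>\<close> vanishes by induction, since the values below \<open>T \<inter> S\<close> already
  sum to \<open>0\<close>.  Below the socle, Weisner's theorem for a minimal normal subgroup \<open>M\<close> of \<open>G\<close> contained
  in \<open>T\<close> gives \<open>\<mu>(1, T) = - \<Sum> \<mu>(1, N)\<close> over the normal complements \<open>N\<close> of \<open>M\<close> in \<open>T\<close>.  For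
  non-Abelian \<open>M\<close> there is exactly one complement.  For Abelian \<open>M\<close>, isomorphic to \<open>A\<^sub>i\<close>, there are
  \<open>|Hom(N, A\<^sub>i)| = q\<^sub>i\<^bsup>\<alpha>\<^sub>i - 1\<^esup>\<close> of them, whence the exponent \<open>\<alpha>\<^sub>i choose 2\<close>.
  The exponents \<open>\<alpha>\<^sub>i\<close> enter the induction only through \<open>|Hom(T, A\<^sub>i)| = q\<^sub>i\<^bsup>\<alpha>\<^sub>i\<^esup>\<close>, which is
  multiplicative along \<open>T = M \<times> N\<close>; so no Krull--Schmidt theorem is needed.
\<close>

section \<open>The Moebius function of a lattice of normal subgroups\<close>

lemma mobius_normal_lattice_sum:
  assumes "finite (carrier G)" "H \<lhd> G" "T \<lhd> G" "H \<subset> T"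
  shows "(\<Sum>N\<in>{N. N \<lhd> G \<and> H \<subseteq> N \<and> N \<subseteq> T}. mobius (normal_lattice G) H N) = 0"
  using mobius_sum[OF normal_lattice_partial_order normal_lattice_finite, of G H T] assms
  by (simp add: lless_def psubset_eq)

lemma mobius_normal_lattice_refl:
  assumes "finite (carrier G)" "H \<lhd> G"
  shows "mobius (normal_lattice G) H H = 1"
  by (rule mobius_refl) (use assms normal_lattice_partial_order normal_lattice_finite in auto)

text \<open>The predicate \<open>P\<close> is left free so that one finiteness fact serves all the
  index sets below; some of these carry extra parentheses to fit its shape.\<close>

lemma finite_normal_subgroups:
  assumes "finite (carrier G)"
  shows "finite {N. N \<lhd> G \<and> P N}"
  using normal_lattice_finite[OF assms] by (rule rev_finite_subset) auto

text \<open>The recursion over proper subgroups only: the form in which two lattices can be compared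
  by induction.\<close>

lemma mobius_normal_lattice_eq:
  assumes "finite (carrier G)" "H \<lhd> G" "T \<lhd> G" "H \<subset> T"
  shows "mobius (normal_lattice G) H T =
    - (\<Sum>N\<in>{N. N \<lhd> G \<and> H \<subseteq> N \<and> N \<subset> T}. mobius (normal_lattice G) H N)"
proof -
  have "{N. N \<lhd> G \<and> H \<subseteq> N \<and> N \<subseteq> T} = insert T {N. N \<lhd> G \<and> H \<subseteq> N \<and> N \<subset> T}"
    using assms by auto
  then show ?thesis
    using mobius_normal_lattice_sum[OF assms] finite_normal_subgroups[OF assms(1)]
    by (simp add: psubset_eq)
qed

lemma (in group) normal_subgroup_finite: "finite (carrier G) \<Longrightarrow> N \<lhd> G \<Longrightarrow> finite N"
  by (meson finite_subset normal_imp_subgroup subgroup.subset)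

section \<open>Passage from the interval above \<open>H\<close> to the quotient group\<close>

lemma (in normal) rcosets_restrict:
  "rcosets\<^bsub>G\<lparr>carrier := N\<rparr>\<^esub> H = (\<lambda>x. H #> x) ` N"
  by (auto simp: RCOSETS_def r_coset_def)

lemma (in normal) Union_rcosets_restrict:
  assumes "subgroup N G" "H \<subseteq> N"
  shows "\<Union> (rcosets\<^bsub>G\<lparr>carrier := N\<rparr>\<^esub> H) = N"
proof -
  have "H #> x \<subseteq> N" if "x \<in> N" for x
    using assms that subgroup.m_closed by (fastforce simp: r_coset_def)
  moreover have "x \<in> H #> x" if "x \<in> N" for x
    using assms that by (meson is_subgroup rcos_self subgroup.mem_carrier)
  ultimately show ?thesis by (auto simp: rcosets_restrict)
qed

text \<open>The correspondence theorem for proper intervals: the inverse map sends a normal subgroup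
  of the quotient, a set of cosets, to its union. \<open>T\<close> and its image are left out to
  match the recursion of the Moebius function.\<close>

lemma (in normal) bij_betw_normal_quotient:
  assumes "T \<lhd> G" "H \<subseteq> T"
  shows "bij_betw (\<lambda>N. rcosets\<^bsub>G\<lparr>carrier := N\<rparr>\<^esub> H) {N. N \<lhd> G \<and> H \<subseteq> N \<and> N \<subset> T}
    {K. K \<lhd> G Mod H \<and> {H} \<subseteq> K \<and> K \<subset> rcosets\<^bsub>G\<lparr>carrier := T\<rparr>\<^esub> H}"
proof -
  let ?q = "\<lambda>N. rcosets\<^bsub>G\<lparr>carrier := N\<rparr>\<^esub> H"
  have U: "\<Union> (?q N) = N" if "N \<lhd> G" "H \<subseteq> N" for N
    using that Union_rcosets_restrict normal_imp_subgroup by blast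
  have q: "?q N \<lhd> G Mod H \<and> {H} \<subseteq> ?q N" if "N \<lhd> G" "H \<subseteq> N" for N
  proof -
    have "?q N \<lhd> G Mod H" using normality_factorization normal_axioms that by blast
    moreover from this have "H \<in> ?q N"
      by (metis normal_imp_subgroup one_FactGroup subgroup.one_closed)
    ultimately show ?thesis by simp
  qed
  have mono: "?q N \<subseteq> ?q K" if "N \<subseteq> K" for N K
    using that by (auto simp: rcosets_restrict)
  have K: "\<Union> K \<lhd> G \<and> H \<subseteq> \<Union> K \<and> ?q (\<Union> K) = K" if "K \<lhd> G Mod H" for K
    using that factgroup_subgroup_union_normal factgroup_subgroup_union_factor
      normal_imp_subgroup[OF that] subgroup.one_closed[OF normal_imp_subgroup[OF that]]
    by (metis Union_upper one_FactGroup)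
  show ?thesis
  proof (rule bij_betw_byWitness[where f' = Union])
    show "?q ` {N. N \<lhd> G \<and> H \<subseteq> N \<and> N \<subset> T} \<subseteq> {K. K \<lhd> G Mod H \<and> {H} \<subseteq> K \<and> K \<subset> ?q T}"
    proof (intro image_subsetI CollectI conjI)
      fix N assume "N \<in> {N. N \<lhd> G \<and> H \<subseteq> N \<and> N \<subset> T}"
      then have N: "N \<lhd> G" "H \<subseteq> N" "N \<subset> T" by auto
      then show "?q N \<lhd> G Mod H" "{H} \<subseteq> ?q N" using q by auto
      \<comment> \<open>The inclusion stays proper because the union of the cosets gives
        \<open>N\<close> back.\<close>
      show "?q N \<subset> ?q T" using N U assms mono by (metis psubset_eq)
    qed
    show "Union ` {K. K \<lhd> G Mod H \<and> {H} \<subseteq> K \<and> K \<subset> ?q T} \<subseteq> {N. N \<lhd> G \<and> H \<subseteq> N \<and> N \<subset> T}"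
    proof (intro image_subsetI CollectI conjI)
      fix L assume "L \<in> {K. K \<lhd> G Mod H \<and> {H} \<subseteq> K \<and> K \<subset> ?q T}"
      then have L: "L \<lhd> G Mod H" "L \<subset> ?q T" by auto
      then show "\<Union> L \<lhd> G" "H \<subseteq> \<Union> L" using K by auto
      show "\<Union> L \<subset> T" using L K U[OF assms] by (metis Union_mono psubset_eq)
    qed
  qed (use U K in auto)
qed

text \<open>Both sides obey the same recursion, and the correspondence theorem matches its summands,
  so induction on the order of \<open>T\<close> applies. From here on the lower end of the interval
  is the trivial subgroup.\<close>

lemma mobius_quotient:
  assumes "finite (carrier G)" "H \<lhd> G" "T \<lhd> G" "H \<subseteq> T"
  shows "mobius (normal_lattice G) H T =
    mobius (normal_lattice (G Mod H)) {\<one>\<^bsub>G Mod H\<^esub>} (carrier (G\<lparr>carrier := T\<rparr> Mod H))"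
  using assms(3,4)
proof (induction "card T" arbitrary: T rule: less_induct)
  case less
  interpret normal H G by fact
  interpret Q: group "G Mod H" by (rule factorgroup_is_group)
  have finQ: "finite (carrier (G Mod H))"
    using assms(1) by (simp add: carrier_FactGroup)
  let ?q = "\<lambda>N. rcosets\<^bsub>G\<lparr>carrier := N\<rparr>\<^esub> H"
  have car: "carrier (G\<lparr>carrier := N\<rparr> Mod H) = ?q N" for N
    by (simp add: FactGroup_def)
  have qn: "?q N \<lhd> G Mod H" if "N \<lhd> G" "H \<subseteq> N" for N
    using normality_factorization normal_axioms that by blast
  have H1: "{H} \<lhd> G Mod H" using Q.one_is_normal by simp
  have qH: "?q H = {H}"
    using rcos_const[OF is_group] subgroup.one_closed[OF is_subgroup]
    by (auto simp: rcosets_restrict intro!: image_eqI[of _ _ "\<one>\<^bsub>G\<^esub>"])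
  have U: "\<Union> (?q N) = N" if "N \<lhd> G" "H \<subseteq> N" for N
    using that Union_rcosets_restrict normal_imp_subgroup by blast
  show ?case
  proof (cases "H = T")
    case True
    then show ?thesis
      using mobius_normal_lattice_refl[OF assms(1,2)] mobius_normal_lattice_refl[OF finQ H1] qH
      by (simp add: FactGroup_def)
  next
    case False
    then have HT: "H \<subset> T" using less by auto
    have "{H} \<subseteq> ?q T"
      using subgroup.one_closed[OF normal_imp_subgroup[OF qn]] less by simp
    moreover have "{H} \<noteq> ?q T" using U[OF less.prems] False by auto
    ultimately have lt: "{H} \<subset> ?q T" by auto
    have "mobius (normal_lattice G) H T
        = - (\<Sum>N\<in>{N. N \<lhd> G \<and> H \<subseteq> N \<and> N \<subset> T}. mobius (normal_lattice G) H N)"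
      by (rule mobius_normal_lattice_eq) (use assms less HT in auto)
    also have "\<dots> = - (\<Sum>N\<in>{N. N \<lhd> G \<and> H \<subseteq> N \<and> N \<subset> T}.
        mobius (normal_lattice (G Mod H)) {H} (?q N))"
    proof (intro arg_cong[of _ _ uminus] sum.cong refl)
      fix N assume N: "N \<in> {N. N \<lhd> G \<and> H \<subseteq> N \<and> N \<subset> T}"
      then have "card N < card T"
        using normal_subgroup_finite[OF assms(1)] less.prems by (auto intro!: psubset_card_mono)
      then show "mobius (normal_lattice G) H N = mobius (normal_lattice (G Mod H)) {H} (?q N)"
        using less.hyps N by (simp add: FactGroup_def)
    qed
    also have "\<dots> = - (\<Sum>K\<in>{K. K \<lhd> G Mod H \<and> {H} \<subseteq> K \<and> K \<subset> ?q T}.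
        mobius (normal_lattice (G Mod H)) {H} K)"
      using sum.reindex_bij_betw[OF bij_betw_normal_quotient[OF less.prems]] by simp
    also have "\<dots> = mobius (normal_lattice (G Mod H)) {H} (?q T)"
      by (rule mobius_normal_lattice_eq[symmetric]) (use finQ H1 qn less lt in auto)
    finally show ?thesis by (simp add: car)
  qed
qed

section \<open>Products of normal subgroups and minimal normal subgroups\<close>

context group
begin

lemma normal_mem_carrier: "N \<lhd> G \<Longrightarrow> x \<in> N \<Longrightarrow> x \<in> carrier G"
  by (meson normal_imp_subgroup subgroup.mem_carrier)

lemma one_in_normal: "N \<lhd> G \<Longrightarrow> \<one> \<in> N"
  by (meson normal_imp_subgroup subgroup.one_closed)

lemma normal_m_closed: "N \<lhd> G \<Longrightarrow> x \<in> N \<Longrightarrow> y \<in> N \<Longrightarrow> x \<otimes> y \<in> N"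
  by (meson normal_imp_subgroup subgroup.m_closed)

lemma normal_inv_closed: "N \<lhd> G \<Longrightarrow> x \<in> N \<Longrightarrow> inv x \<in> N"
  by (meson normal_imp_subgroup subgroup.m_inv_closed)

lemma set_mult_upper:
  assumes "N \<lhd> G" "K \<lhd> G"
  shows "N \<subseteq> N <#> K" "K \<subseteq> N <#> K"
proof -
  have "x = x \<otimes> \<one>" "x \<in> N" "\<one> \<in> K" if "x \<in> N" for x
    using assms that normal_mem_carrier one_in_normal by auto
  then show "N \<subseteq> N <#> K" unfolding set_mult_def by blast
  have "x = \<one> \<otimes> x" "x \<in> K" "\<one> \<in> N" if "x \<in> K" for x
    using assms that normal_mem_carrier one_in_normal by auto
  then show "K \<subseteq> N <#> K" unfolding set_mult_def by blast
qed

lemma set_mult_least: "L \<lhd> G \<Longrightarrow> N \<subseteq> L \<Longrightarrow> K \<subseteq> L \<Longrightarrow> N <#> K \<subseteq> L"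
  using normal_m_closed unfolding set_mult_def by blast

lemma set_mult_absorb:
  assumes "N \<lhd> G" "K \<lhd> G" "K \<subseteq> N"
  shows "N <#> K = N"
  using set_mult_upper(1)[OF assms(1,2)] set_mult_least[OF assms(1) order_refl assms(3)] by blast

text \<open>The intersection is a normal subgroup inside the minimal \<open>M\<close>, and it is not
  all of \<open>M\<close>.\<close>

lemma minimal_normal_Int:
  assumes "minimal_normal G M" "N \<lhd> G" "\<not> M \<subseteq> N"
  shows "N \<inter> M = {\<one>}"
  using assms normal_subgroup_intersect[of N M] unfolding minimal_normal_def by (metis inf_le1 inf_le2)

lemma minimal_normal_exists:
  assumes "finite (carrier G)" "T \<lhd> G" "T \<noteq> {\<one>}"
  obtains M where "minimal_normal G M" "M \<subseteq> T"
proof -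
  let ?F = "{K. K \<lhd> G \<and> (K \<noteq> {\<one>} \<and> K \<subseteq> T)}"
  have "\<exists>M\<in>?F. M \<subseteq> T \<and> (\<forall>K\<in>?F. K \<subseteq> M \<longrightarrow> M = K)"
    by (rule finite_has_minimal2) (use finite_normal_subgroups[OF assms(1)] assms in auto)
  then obtain M where "M \<in> ?F" "\<forall>K\<in>?F. K \<subseteq> M \<longrightarrow> M = K" by blast
  then have "minimal_normal G M" "M \<subseteq> T"
    unfolding minimal_normal_def by auto
  then show ?thesis by (rule that)
qed

section \<open>The socle and the vanishing of the Moebius function outside it\<close>

lemma socle_normal: "socle G \<lhd> G"
  unfolding socle_def
proof (rule normal_generateI)
  show "\<Union> {N. minimal_normal G N} \<subseteq> carrier G"
    using normal_mem_carrier unfolding minimal_normal_def by blast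
  show "g \<otimes> h \<otimes> inv g \<in> \<Union> {N. minimal_normal G N}"
    if "h \<in> \<Union> {N. minimal_normal G N}" "g \<in> carrier G" for h g
    using that normal.inv_op_closed2 unfolding minimal_normal_def by fast
qed

lemma minimal_normal_subset_socle: "minimal_normal G M \<Longrightarrow> M \<subseteq> socle G"
  unfolding socle_def by (auto intro: generate.incl)

lemma socle_least:
  assumes "L \<lhd> G" "\<And>M. minimal_normal G M \<Longrightarrow> M \<subseteq> L"
  shows "socle G \<subseteq> L"
  unfolding socle_def using assms normal_imp_subgroup by (intro generate_subgroup_incl) auto

text \<open>The normal subgroups inside \<open>T\<close> are of three sorts: \<open>T\<close>
  itself, those inside \<open>socle G \<inter> T\<close>, whose values sum to 0, and the remaining
  ones, whose values are 0 by induction. As the total is 0, the value at \<open>T\<close> is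
  0.\<close>

lemma mobius_eq_0_outside_socle:
  assumes fin: "finite (carrier G)" and "T \<lhd> G" "\<not> T \<subseteq> socle G"
  shows "mobius (normal_lattice G) {\<one>} T = 0"
  using assms(2,3)
proof (induction "card T" arbitrary: T rule: less_induct)
  case less
  let ?m = "mobius (normal_lattice G) {\<one>}"
  let ?A = "{N. N \<lhd> G \<and> {\<one>} \<subseteq> N \<and> N \<subseteq> T}"
  let ?S = "socle G \<inter> T"
  let ?B = "{N. N \<lhd> G \<and> {\<one>} \<subseteq> N \<and> N \<subseteq> ?S}"
  have T1: "T \<noteq> {\<one>}" using less one_in_normal[OF socle_normal] by auto
  obtain M where M: "minimal_normal G M" "M \<subseteq> T"
    using minimal_normal_exists[OF fin less.prems(1) T1] by blast
  have S: "?S \<lhd> G" by (rule normal_subgroup_intersect[OF socle_normal less.prems(1)])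
  \<comment> \<open>A minimal normal subgroup inside \<open>T\<close> also lies in the socle. Hence
    the interval below \<open>?S\<close> is not a single point, and its Moebius sum
    vanishes.\<close>
  have "?S \<noteq> {\<one>}"
  proof -
    have "M \<noteq> {\<one>}" "\<one> \<in> M" using M(1) one_in_normal by (auto simp: minimal_normal_def)
    then show ?thesis using minimal_normal_subset_socle[OF M(1)] M(2) by blast
  qed
  then have "(\<Sum>N\<in>?B. ?m N) = 0"
    using mobius_normal_lattice_sum[OF fin one_is_normal S] one_in_normal[OF S] by auto
  moreover have "(\<Sum>N\<in>?A. ?m N) = 0"
    using mobius_normal_lattice_sum[OF fin one_is_normal less.prems(1)] T1
      one_in_normal[OF less.prems(1)] by auto
  moreover have "(\<Sum>N\<in>?A. ?m N) = ?m T + (\<Sum>N\<in>?B. ?m N)"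
  proof -
    have "(\<Sum>N\<in>?A. ?m N) = (\<Sum>N\<in>insert T ?B. ?m N)"
    proof (rule sum.mono_neutral_right)
      show "\<forall>N\<in>?A - insert T ?B. ?m N = 0"
      proof
        fix N assume N: "N \<in> ?A - insert T ?B"
        then have "N \<subset> T" "\<not> N \<subseteq> socle G" by auto
        moreover have "card N < card T"
          using \<open>N \<subset> T\<close> normal_subgroup_finite[OF fin less.prems(1)] by (intro psubset_card_mono)
        moreover have "N \<lhd> G" using N by simp
        ultimately show "?m N = 0" using less.hyps by simp
      qed
    qed (use finite_normal_subgroups[OF fin] less.prems one_in_normal in auto)
    also have "\<dots> = ?m T + (\<Sum>N\<in>?B. ?m N)"
      using finite_normal_subgroups[OF fin] less.prems(2) by (intro sum.insert) auto
    finally show ?thesis .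
  qed
  ultimately show ?case by simp
qed

text \<open>Group the zero sum over all normal subgroups \<open>N\<close> of the group inside
  \<open>T\<close> by the product \<open>R = N <#> M\<close>. By induction every fibre with
  \<open>R \<noteq> T\<close> sums to 0, so the fibre over \<open>T\<close> does too.\<close>

lemma weisner:
  assumes fin: "finite (carrier G)" and M: "M \<lhd> G" "M \<noteq> {\<one>}" and "T \<lhd> G" "M \<subseteq> T"
  shows "(\<Sum>N\<in>{N. N \<lhd> G \<and> N <#> M = T}. mobius (normal_lattice G) {\<one>} N) = 0"
  using assms(4,5)
proof (induction "card T" arbitrary: T rule: less_induct)
  case less
  let ?m = "mobius (normal_lattice G) {\<one>}"
  let ?A = "{N. N \<lhd> G \<and> {\<one>} \<subseteq> N \<and> N \<subseteq> T}"
  let ?R = "{R. R \<lhd> G \<and> (M \<subseteq> R \<and> R \<subseteq> T)}"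
  have T1: "{\<one>} \<subset> T" using M less.prems one_in_normal[OF M(1)] by auto
  \<comment> \<open>The product with \<open>M\<close> bounds \<open>N\<close> by \<open>R\<close>,
    hence by \<open>T\<close>. So the fibre over \<open>R\<close> does not depend on
    \<open>T\<close>, and the induction hypothesis speaks of the same set.\<close>
  have fib: "{N \<in> ?A. N <#> M = R} = {N. N \<lhd> G \<and> N <#> M = R}" if "R \<in> ?R" for R
  proof -
    have "N \<subseteq> T" "\<one> \<in> N" if "N \<lhd> G" "N <#> M = R" for N
      using set_mult_upper(1)[OF that(1) M(1)] that \<open>R \<in> ?R\<close> one_in_normal by auto
    then show ?thesis by auto
  qed
  have "0 = (\<Sum>N\<in>?A. ?m N)"
    using mobius_normal_lattice_sum[OF fin one_is_normal less.prems(1) T1] by simp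
  also have "\<dots> = (\<Sum>R\<in>?R. \<Sum>N\<in>{N \<in> ?A. N <#> M = R}. ?m N)"
  proof (rule sum.group[symmetric])
    show "(\<lambda>N. N <#> M) ` ?A \<subseteq> ?R"
    proof (intro image_subsetI CollectI conjI)
      fix N assume "N \<in> ?A"
      then show "N <#> M \<lhd> G" "M \<subseteq> N <#> M" "N <#> M \<subseteq> T"
        by (simp_all add: normal_subgroup_set_mult_closed set_mult_upper set_mult_least M less.prems)
    qed
  qed (use finite_normal_subgroups[OF fin] in auto)
  also have "\<dots> = (\<Sum>R\<in>?R. \<Sum>N\<in>{N. N \<lhd> G \<and> N <#> M = R}. ?m N)"
    using fib by (intro sum.cong refl) auto
  also have "\<dots> = (\<Sum>R\<in>{T}. \<Sum>N\<in>{N. N \<lhd> G \<and> N <#> M = R}. ?m N)"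
  proof (rule sum.mono_neutral_right)
    show "\<forall>R\<in>?R - {T}. (\<Sum>N\<in>{N. N \<lhd> G \<and> N <#> M = R}. ?m N) = 0"
    proof
      fix R assume R: "R \<in> ?R - {T}"
      then have "card R < card T" "R \<lhd> G" "M \<subseteq> R"
        using normal_subgroup_finite[OF fin less.prems(1)] by (auto intro!: psubset_card_mono)
      then show "(\<Sum>N\<in>{N. N \<lhd> G \<and> N <#> M = R}. ?m N) = 0" by (rule less.hyps)
    qed
  qed (use finite_normal_subgroups[OF fin] less.prems in auto)
  finally show ?case by simp
qed

text \<open>These are lattice complements in the interval from 1 to \<open>T\<close>: normality
  refers to the whole group. For normal \<open>M\<close> they are the \<open>N\<close> for which
  \<open>T\<close> is the internal direct product of \<open>M\<close> and \<open>N\<close>.\<close>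

definition complements :: "'a set \<Rightarrow> 'a set \<Rightarrow> 'a set set" where
  "complements M T = {N. N \<lhd> G \<and> N <#> M = T \<and> N \<inter> M = {\<one>}}"

text \<open>A normal \<open>N\<close> with \<open>N <#> M = T\<close> either contains the minimal
  \<open>M\<close>, and then equals \<open>T\<close>, or meets it trivially. Weisner's sum therefore
  isolates the value at \<open>T\<close>.\<close>

lemma mobius_complements:
  assumes fin: "finite (carrier G)" and M: "minimal_normal G M" and T: "T \<lhd> G" "M \<subseteq> T"
  shows "mobius (normal_lattice G) {\<one>} T =
    - (\<Sum>N\<in>complements M T. mobius (normal_lattice G) {\<one>} N)"
proof -
  have Mn: "M \<lhd> G" "M \<noteq> {\<one>}" using M unfolding minimal_normal_def by auto
  have TM: "T \<inter> M \<noteq> {\<one>}" using T Mn by auto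
  have "{N. N \<lhd> G \<and> N <#> M = T} = insert T (complements M T)"
  proof (intro equalityI subsetI)
    fix N assume "N \<in> {N. N \<lhd> G \<and> N <#> M = T}"
    then have N: "N \<lhd> G" "N <#> M = T" by auto
    show "N \<in> insert T (complements M T)"
    proof (cases "M \<subseteq> N")
      case True
      then have "N = T" using N set_mult_absorb[OF _ Mn(1)] by auto
      then show ?thesis by simp
    next
      case False
      then show ?thesis using N minimal_normal_Int[OF M N(1)] by (simp add: complements_def)
    qed
  next
    fix N assume "N \<in> insert T (complements M T)"
    then show "N \<in> {N. N \<lhd> G \<and> N <#> M = T}"
      using T set_mult_absorb[OF T(1) Mn(1) T(2)] by (elim insertE) (simp_all add: complements_def)
  qed
  moreover have "T \<notin> complements M T" using TM by (auto simp: complements_def)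
  moreover have "finite (complements M T)"
    unfolding complements_def by (rule finite_normal_subgroups[OF fin])
  ultimately show ?thesis using weisner[OF fin Mn T] by simp
qed

text \<open>Semisimplicity of the socle. It supplies one complement, from which all others are then
  counted.\<close>

lemma complements_nonempty:
  assumes fin: "finite (carrier G)" and K: "K \<lhd> G" and T: "T \<lhd> G" "K \<subseteq> T" "T \<subseteq> socle G"
  shows "complements K T \<noteq> {}"
proof -
  \<comment> \<open>maximality of \<open>N\<close> forces \<open>N K\<close> to contain the whole socle; Dedekind's law then descends to \<open>T\<close>\<close>
  let ?F = "{N. N \<lhd> G \<and> N \<inter> K = {\<one>}}"
  have "\<exists>N\<in>?F. {\<one>} \<subseteq> N \<and> (\<forall>L\<in>?F. N \<subseteq> L \<longrightarrow> N = L)"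
    by (rule finite_has_maximal2)
      (use finite_normal_subgroups[OF fin] one_is_normal one_in_normal[OF K] in auto)
  then obtain N where "N \<in> ?F" and "\<forall>L\<in>?F. N \<subseteq> L \<longrightarrow> N = L" by meson
  then have N: "N \<lhd> G" "N \<inter> K = {\<one>}"
    and max: "\<And>L. L \<lhd> G \<Longrightarrow> L \<inter> K = {\<one>} \<Longrightarrow> N \<subseteq> L \<Longrightarrow> N = L" by simp_all
  have NK: "N <#> K \<lhd> G" by (rule normal_subgroup_set_mult_closed[OF N(1) K])
  have "socle G \<subseteq> N <#> K"
  proof (rule socle_least[OF NK], rule ccontr)
    fix R assume R: "minimal_normal G R" "\<not> R \<subseteq> N <#> K"
    then have Rn: "R \<lhd> G" by (simp add: minimal_normal_def)
    have RNK: "(N <#> K) \<inter> R = {\<one>}" by (rule minimal_normal_Int[OF R(1) NK R(2)])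
    have NR: "N <#> R \<lhd> G" by (rule normal_subgroup_set_mult_closed[OF N(1) Rn])
    \<comment> \<open>If \<open>k = n \<otimes> r\<close>, then \<open>r\<close> lies in both
      \<open>R\<close> and \<open>N <#> K\<close>, so it is trivial and \<open>k\<close> lies in
      \<open>N \<inter> K\<close>. Thus \<open>N <#> R\<close> competes with the maximal
      \<open>N\<close>, which forces \<open>R\<close> into \<open>N\<close>.\<close>
    have "(N <#> R) \<inter> K \<subseteq> {\<one>}"
    proof
      fix k assume "k \<in> (N <#> R) \<inter> K"
      then obtain n r where nr: "n \<in> N" "r \<in> R" "k = n \<otimes> r" "k \<in> K"
        unfolding set_mult_def by auto
      then have "r = inv n \<otimes> k"
        using normal_mem_carrier N(1) Rn K by (metis inv_solve_left)
      then have "r \<in> N <#> K"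
        using nr normal_inv_closed[OF N(1)] unfolding set_mult_def by auto
      then have "r = \<one>" using RNK nr by auto
      then have "k \<in> N" using nr normal_mem_carrier[OF N(1)] by simp
      then show "k \<in> {\<one>}" using N(2) nr by auto
    qed
    then have "(N <#> R) \<inter> K = {\<one>}" using one_in_normal[OF NR] one_in_normal[OF K] by auto
    then have "N = N <#> R" by (rule max[OF NR _ set_mult_upper(1)[OF N(1) Rn]])
    then have "R \<subseteq> N <#> K" using set_mult_upper(2)[OF N(1) Rn] set_mult_upper(1)[OF N(1) K] by auto
    then show False using R(2) by simp
  qed
  then have TNK: "T \<subseteq> N <#> K" using T by auto
  have NT: "N \<inter> T \<lhd> G" by (rule normal_subgroup_intersect[OF N(1) T(1)])
  have "T \<subseteq> (N \<inter> T) <#> K"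
  proof
    fix t assume t: "t \<in> T"
    then obtain n k where nk: "n \<in> N" "k \<in> K" "t = n \<otimes> k" using TNK unfolding set_mult_def by auto
    then have "n = t \<otimes> inv k" using normal_mem_carrier N(1) K by (simp add: inv_solve_right)
    then have "n \<in> T" using t nk T normal_m_closed normal_inv_closed by blast
    then show "t \<in> (N \<inter> T) <#> K" using nk unfolding set_mult_def by auto
  qed
  then have "(N \<inter> T) <#> K = T" using set_mult_least[OF T(1) inf_le2 T(2)] by (rule equalityI[rotated])
  then have "N \<inter> T \<in> complements K T"
    using NT N(2) T(2) by (simp add: complements_def inf.assoc inf.absorb2)
  then show ?thesis by blast
qed

end

section \<open>Equivariant homomorphisms\<close>

text \<open>In classical terms \<open>X\<close> is a group with operators, the operators being the
  elements of \<open>carrier G\<close>.\<close>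

definition acts_by_endos :: "('g, 'm) monoid_scheme \<Rightarrow> ('x, 'n) monoid_scheme \<Rightarrow> ('g \<Rightarrow> 'x \<Rightarrow> 'x) \<Rightarrow> bool" where
  "acts_by_endos G X r \<longleftrightarrow> group X \<and> (\<forall>g\<in>carrier G. r g \<in> hom X X)"

text \<open>The operator homomorphisms. Extensionality makes the cardinality count maps on
  \<open>carrier X\<close>, in agreement with \<open>equivariant_endos\<close>.\<close>

definition equivariant_homs ::
  "('g, 'm) monoid_scheme \<Rightarrow> ('x, 'n) monoid_scheme \<Rightarrow> ('g \<Rightarrow> 'x \<Rightarrow> 'x)
     \<Rightarrow> ('y, 'k) monoid_scheme \<Rightarrow> ('g \<Rightarrow> 'y \<Rightarrow> 'y) \<Rightarrow> ('x \<Rightarrow> 'y) set" where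
  "equivariant_homs G X r Y s =
     {f \<in> hom X Y \<inter> extensional (carrier X). \<forall>g\<in>carrier G. \<forall>x\<in>carrier X. f (r g x) = s g (f x)}"

definition direct_act :: "('g \<Rightarrow> 'x \<Rightarrow> 'x) \<Rightarrow> ('g \<Rightarrow> 'y \<Rightarrow> 'y) \<Rightarrow> 'g \<Rightarrow> 'x \<times> 'y \<Rightarrow> 'x \<times> 'y" where
  "direct_act r s g = (\<lambda>(x, y). (r g x, s g y))"

text \<open>The action may vary with the index, as it does for powers with different exponents.
  \<open>power_act\<close> is an instance, and \<open>socle_type_act\<close> is built from instances
  by \<open>direct_act\<close>.\<close>

definition product_act :: "'i set \<Rightarrow> ('i \<Rightarrow> 'g \<Rightarrow> 'x \<Rightarrow> 'x) \<Rightarrow> 'g \<Rightarrow> ('i \<Rightarrow> 'x) \<Rightarrow> 'i \<Rightarrow> 'x" where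
  "product_act I r g u = (\<lambda>i\<in>I. r i g (u i))"

lemma acts_by_endosD:
  assumes "acts_by_endos G X r"
  shows "group X"
    and "g \<in> carrier G \<Longrightarrow> x \<in> carrier X \<Longrightarrow> r g x \<in> carrier X"
    and "g \<in> carrier G \<Longrightarrow> x \<in> carrier X \<Longrightarrow> y \<in> carrier X \<Longrightarrow>
      r g (x \<otimes>\<^bsub>X\<^esub> y) = r g x \<otimes>\<^bsub>X\<^esub> r g y"
    and "g \<in> carrier G \<Longrightarrow> r g \<one>\<^bsub>X\<^esub> = \<one>\<^bsub>X\<^esub>"
  using assms by (auto simp: acts_by_endos_def hom_in_carrier hom_mult intro: hom_one)

lemma acts_by_endos_direct:
  assumes "acts_by_endos G X r" "acts_by_endos G Y s"
  shows "acts_by_endos G (X \<times>\<times> Y) (direct_act r s)"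
  using assms DirProd_group
  by (fastforce simp: acts_by_endos_def hom_def direct_act_def Pi_iff)

lemma acts_by_endos_product:
  assumes "\<And>i. i \<in> I \<Longrightarrow> acts_by_endos G (X i) (r i)"
  shows "acts_by_endos G (product_group I X) (product_act I r)"
  unfolding acts_by_endos_def
proof (intro conjI ballI homI)
  show "group (product_group I X)" using assms by (simp add: acts_by_endos_def)
  show "product_act I r g u \<in> carrier (product_group I X)"
    if "g \<in> carrier G" "u \<in> carrier (product_group I X)" for g u
    using that acts_by_endosD(2)[OF assms] by (auto simp: product_act_def PiE_iff)
  show "product_act I r g (u \<otimes>\<^bsub>product_group I X\<^esub> v) =
      product_act I r g u \<otimes>\<^bsub>product_group I X\<^esub> product_act I r g v"
    if "g \<in> carrier G" "u \<in> carrier (product_group I X)" "v \<in> carrier (product_group I X)" for g u v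
    using that acts_by_endosD(3)[OF assms] by (auto simp: product_act_def PiE_iff)
qed

lemma equivariant_homsD:
  assumes "f \<in> equivariant_homs G X r Y s"
  shows "f \<in> hom X Y" "f \<in> extensional (carrier X)"
    and "x \<in> carrier X \<Longrightarrow> f x \<in> carrier Y"
    and "x \<in> carrier X \<Longrightarrow> y \<in> carrier X \<Longrightarrow> f (x \<otimes>\<^bsub>X\<^esub> y) = f x \<otimes>\<^bsub>Y\<^esub> f y"
    and "g \<in> carrier G \<Longrightarrow> x \<in> carrier X \<Longrightarrow> f (r g x) = s g (f x)"
  using assms by (auto simp: equivariant_homs_def hom_in_carrier hom_mult)

text \<open>The map \<open>f\<close> is given on the whole type and cut down to the carrier. That
  \<open>X\<close> is a group on which \<open>r\<close> acts keeps all arguments inside the carrier,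
  where the restriction changes nothing.\<close>

lemma equivariant_homsI:
  assumes "\<And>x. x \<in> carrier X \<Longrightarrow> f x \<in> carrier Y"
    and "\<And>x y. x \<in> carrier X \<Longrightarrow> y \<in> carrier X \<Longrightarrow> f (x \<otimes>\<^bsub>X\<^esub> y) = f x \<otimes>\<^bsub>Y\<^esub> f y"
    and "\<And>g x. g \<in> carrier G \<Longrightarrow> x \<in> carrier X \<Longrightarrow> f (r g x) = s g (f x)"
    and "acts_by_endos G X r"
  shows "restrict f (carrier X) \<in> equivariant_homs G X r Y s"
  using assms acts_by_endosD(2)[OF assms(4)] group.is_monoid[OF acts_by_endosD(1)[OF assms(4)]]
  by (auto simp: equivariant_homs_def hom_def monoid.m_closed)

lemma finite_equivariant_homs:
  assumes "finite (carrier X)" "finite (carrier Y)"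
  shows "finite (equivariant_homs G X r Y s)"
proof (rule finite_subset)
  show "equivariant_homs G X r Y s \<subseteq> carrier X \<rightarrow>\<^sub>E carrier Y"
    by (auto simp: equivariant_homs_def hom_def PiE_def)
qed (use assms in \<open>auto intro: finite_PiE\<close>)

lemma equivariant_homs_trivial:
  assumes "acts_by_endos G X r" "acts_by_endos G Y s"
  shows "(\<lambda>x\<in>carrier X. \<one>\<^bsub>Y\<^esub>) \<in> equivariant_homs G X r Y s"
  using acts_by_endosD[OF assms(2)]
  by (intro equivariant_homsI assms) (auto simp: group.is_monoid monoid.one_closed monoid.l_one)

section \<open>Counting equivariant homomorphisms out of direct products\<close>

lemma card_equivariant_homs_iso:
  assumes "equivariant_iso G X r X' r'" "acts_by_endos G X r" "acts_by_endos G X' r'"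
  shows "card (equivariant_homs G X r Y s) = card (equivariant_homs G X' r' Y s)"
proof -
  interpret X: group X using acts_by_endosD(1) assms(2) .
  obtain f where f: "f \<in> iso X X'"
    and eq: "\<And>g x. g \<in> carrier G \<Longrightarrow> x \<in> carrier X \<Longrightarrow> f (r g x) = r' g (f x)"
    using assms(1) unfolding equivariant_iso_def by blast
  define k where "k = inv_into (carrier X) f"
  have k: "k \<in> iso X' X" unfolding k_def by (rule X.iso_set_sym[OF f])
  have f_c: "f x \<in> carrier X'" if "x \<in> carrier X" for x
    using f that by (auto simp: iso_def intro: hom_in_carrier)
  have f_m: "f (x \<otimes>\<^bsub>X\<^esub> y) = f x \<otimes>\<^bsub>X'\<^esub> f y" if "x \<in> carrier X" "y \<in> carrier X" for x y
    using f that by (simp add: iso_def hom_mult)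
  have k_c: "k x \<in> carrier X" if "x \<in> carrier X'" for x
    using k that by (auto simp: iso_def intro: hom_in_carrier)
  have k_m: "k (x \<otimes>\<^bsub>X'\<^esub> y) = k x \<otimes>\<^bsub>X\<^esub> k y" if "x \<in> carrier X'" "y \<in> carrier X'" for x y
    using k that by (simp add: iso_def hom_mult)
  have inj: "inj_on f (carrier X)" and im: "f ` carrier X = carrier X'"
    using f by (auto simp: iso_def bij_betw_def)
  have kf: "k (f x) = x" if "x \<in> carrier X" for x
    unfolding k_def by (rule inv_into_f_f[OF inj that])
  have fk: "f (k x) = x" if "x \<in> carrier X'" for x
    unfolding k_def by (rule f_inv_into_f) (use that im in simp)
  \<comment> \<open>The inverse is equivariant too: write \<open>x\<close> as \<open>f (k x)\<close>
    and move the action through \<open>f\<close>.\<close>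
  have k_eq: "k (r' g x) = r g (k x)" if "g \<in> carrier G" "x \<in> carrier X'" for g x
    using that by (metis acts_by_endosD(2)[OF assms(2)] eq fk k_c kf)
  have "bij_betw (\<lambda>h. \<lambda>x\<in>carrier X'. h (k x)) (equivariant_homs G X r Y s) (equivariant_homs G X' r' Y s)"
  proof (rule bij_betw_byWitness[where f' = "\<lambda>h. \<lambda>x\<in>carrier X. h (f x)"])
    show "\<forall>h\<in>equivariant_homs G X r Y s. (\<lambda>x\<in>carrier X. (\<lambda>x\<in>carrier X'. h (k x)) (f x)) = h"
      using f_c kf equivariant_homsD(2) by (fastforce intro!: extensionalityI[of _ "carrier X"])
    show "\<forall>h\<in>equivariant_homs G X' r' Y s. (\<lambda>x\<in>carrier X'. (\<lambda>x\<in>carrier X. h (f x)) (k x)) = h"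
      using k_c fk equivariant_homsD(2) by (fastforce intro!: extensionalityI[of _ "carrier X'"])
    show "(\<lambda>h. \<lambda>x\<in>carrier X'. h (k x)) ` equivariant_homs G X r Y s \<subseteq> equivariant_homs G X' r' Y s"
      using k_c k_m k_eq by (auto intro!: equivariant_homsI assms simp: equivariant_homsD)
    show "(\<lambda>h. \<lambda>x\<in>carrier X. h (f x)) ` equivariant_homs G X' r' Y s \<subseteq> equivariant_homs G X r Y s"
      using f_c f_m eq by (auto intro!: equivariant_homsI assms simp: equivariant_homsD)
  qed
  then show ?thesis by (rule bij_betw_same_card)
qed

text \<open>A homomorphism on the product is determined by its restrictions to the two axes.
  Conversely, commutativity of \<open>Y\<close> makes the pointwise product of two homomorphisms a
  homomorphism, even if \<open>X\<close> and \<open>X'\<close> are non-Abelian.\<close>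

lemma bij_betw_equivariant_homs_direct:
  assumes X: "acts_by_endos G X r" and X': "acts_by_endos G X' r'"
    and Y: "acts_by_endos G Y s" "comm_group Y"
  shows "bij_betw (\<lambda>h. (\<lambda>x\<in>carrier X. h (x, \<one>\<^bsub>X'\<^esub>), \<lambda>x\<in>carrier X'. h (\<one>\<^bsub>X\<^esub>, x)))
    (equivariant_homs G (X \<times>\<times> X') (direct_act r r') Y s)
    (equivariant_homs G X r Y s \<times> equivariant_homs G X' r' Y s)"
proof -
  interpret X: group X using acts_by_endosD(1) X .
  interpret X': group X' using acts_by_endosD(1) X' .
  interpret Y: comm_group Y by fact
  note P = acts_by_endos_direct[OF X X']
  show ?thesis
  proof (rule bij_betw_byWitness[where
        f' = "\<lambda>(h, h'). \<lambda>z\<in>carrier (X \<times>\<times> X'). h (fst z) \<otimes>\<^bsub>Y\<^esub> h' (snd z)"], goal_cases)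
    \<comment> \<open>Cases 1 and 2 are the two round trips; cases 3 and 4 show that each map lands
      in the right set.\<close>
    case 1
    show ?case
    proof
      fix h assume h: "h \<in> equivariant_homs G (X \<times>\<times> X') (direct_act r r') Y s"
      have "h (x, \<one>\<^bsub>X'\<^esub>) \<otimes>\<^bsub>Y\<^esub> h (\<one>\<^bsub>X\<^esub>, x') = h (x, x')" if "x \<in> carrier X" "x' \<in> carrier X'" for x x'
        using equivariant_homsD(4)[OF h, of "(x, \<one>\<^bsub>X'\<^esub>)" "(\<one>\<^bsub>X\<^esub>, x')"] that by simp
      then show "(case (\<lambda>x\<in>carrier X. h (x, \<one>\<^bsub>X'\<^esub>), \<lambda>x\<in>carrier X'. h (\<one>\<^bsub>X\<^esub>, x)) of
          (h, h') \<Rightarrow> \<lambda>z\<in>carrier (X \<times>\<times> X'). h (fst z) \<otimes>\<^bsub>Y\<^esub> h' (snd z)) = h"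
        using equivariant_homsD(2)[OF h] by (auto intro!: extensionalityI[of _ "carrier (X \<times>\<times> X')"])
    qed
  next
    case 2
    have one: "h \<one>\<^bsub>X\<^esub> = \<one>\<^bsub>Y\<^esub>" if "h \<in> equivariant_homs G X r Y s" for h
      using hom_one equivariant_homsD(1)[OF that] X.is_group Y.is_group by blast
    have one': "h \<one>\<^bsub>X'\<^esub> = \<one>\<^bsub>Y\<^esub>" if "h \<in> equivariant_homs G X' r' Y s" for h
      using hom_one equivariant_homsD(1)[OF that] X'.is_group Y.is_group by blast
    show ?case
      using one one'
      by (auto simp: equivariant_homsD(3) intro!: extensionalityI[of _ "carrier X"] extensionalityI[of _ "carrier X'"]
          dest: equivariant_homsD(2))
  next
    case 3
    show ?case
    proof (intro image_subsetI SigmaI)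
      fix h assume h: "h \<in> equivariant_homs G (X \<times>\<times> X') (direct_act r r') Y s"
      show "(\<lambda>x\<in>carrier X. h (x, \<one>\<^bsub>X'\<^esub>)) \<in> equivariant_homs G X r Y s"
      proof (rule equivariant_homsI[OF _ _ _ X])
        show "h (x \<otimes>\<^bsub>X\<^esub> y, \<one>\<^bsub>X'\<^esub>) = h (x, \<one>\<^bsub>X'\<^esub>) \<otimes>\<^bsub>Y\<^esub> h (y, \<one>\<^bsub>X'\<^esub>)"
          if "x \<in> carrier X" "y \<in> carrier X" for x y
          using equivariant_homsD(4)[OF h, of "(x, \<one>\<^bsub>X'\<^esub>)" "(y, \<one>\<^bsub>X'\<^esub>)"] that by simp
        show "h (r g x, \<one>\<^bsub>X'\<^esub>) = s g (h (x, \<one>\<^bsub>X'\<^esub>))" if "g \<in> carrier G" "x \<in> carrier X" for g x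
          using equivariant_homsD(5)[OF h, of g "(x, \<one>\<^bsub>X'\<^esub>)"] acts_by_endosD(4)[OF X'] that
          by (simp add: direct_act_def)
      qed (simp add: equivariant_homsD(3)[OF h])
      show "(\<lambda>x\<in>carrier X'. h (\<one>\<^bsub>X\<^esub>, x)) \<in> equivariant_homs G X' r' Y s"
      proof (rule equivariant_homsI[OF _ _ _ X'])
        show "h (\<one>\<^bsub>X\<^esub>, x \<otimes>\<^bsub>X'\<^esub> y) = h (\<one>\<^bsub>X\<^esub>, x) \<otimes>\<^bsub>Y\<^esub> h (\<one>\<^bsub>X\<^esub>, y)"
          if "x \<in> carrier X'" "y \<in> carrier X'" for x y
          using equivariant_homsD(4)[OF h, of "(\<one>\<^bsub>X\<^esub>, x)" "(\<one>\<^bsub>X\<^esub>, y)"] that by simp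
        show "h (\<one>\<^bsub>X\<^esub>, r' g x) = s g (h (\<one>\<^bsub>X\<^esub>, x))" if "g \<in> carrier G" "x \<in> carrier X'" for g x
          using equivariant_homsD(5)[OF h, of g "(\<one>\<^bsub>X\<^esub>, x)"] acts_by_endosD(4)[OF X] that
          by (simp add: direct_act_def)
      qed (simp add: equivariant_homsD(3)[OF h])
    qed
  next
    case 4
    show ?case
    proof (clarify, rule equivariant_homsI[OF _ _ _ P])
      fix h h' assume h: "h \<in> equivariant_homs G X r Y s" and h': "h' \<in> equivariant_homs G X' r' Y s"
      note H = equivariant_homsD(3-5)[OF h] equivariant_homsD(3-5)[OF h']
      show "h (fst z) \<otimes>\<^bsub>Y\<^esub> h' (snd z) \<in> carrier Y" if "z \<in> carrier (X \<times>\<times> X')" for z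
        using that H by auto
      show "h (fst (z \<otimes>\<^bsub>X \<times>\<times> X'\<^esub> w)) \<otimes>\<^bsub>Y\<^esub> h' (snd (z \<otimes>\<^bsub>X \<times>\<times> X'\<^esub> w)) =
          (h (fst z) \<otimes>\<^bsub>Y\<^esub> h' (snd z)) \<otimes>\<^bsub>Y\<^esub> (h (fst w) \<otimes>\<^bsub>Y\<^esub> h' (snd w))"
        if "z \<in> carrier (X \<times>\<times> X')" "w \<in> carrier (X \<times>\<times> X')" for z w
        using that H by (auto simp: Y.m_ac)
      show "h (fst (direct_act r r' g z)) \<otimes>\<^bsub>Y\<^esub> h' (snd (direct_act r r' g z)) =
          s g (h (fst z) \<otimes>\<^bsub>Y\<^esub> h' (snd z))"
        if "g \<in> carrier G" "z \<in> carrier (X \<times>\<times> X')" for g z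
        using that H acts_by_endosD(3)[OF Y(1)] by (auto simp: direct_act_def)
    qed
  qed
qed

lemma card_equivariant_homs_direct:
  assumes "acts_by_endos G X r" "acts_by_endos G X' r'" "acts_by_endos G Y s" "comm_group Y"
  shows "card (equivariant_homs G (X \<times>\<times> X') (direct_act r r') Y s) =
    card (equivariant_homs G X r Y s) * card (equivariant_homs G X' r' Y s)"
  using bij_betw_same_card[OF bij_betw_equivariant_homs_direct[OF assms]] by (simp add: card_cartesian_product)

text \<open>Splitting off one coordinate reduces indexed products to binary ones, for the induction
  on the index set.\<close>

lemma equivariant_iso_product_insert:
  assumes "i \<notin> I" "\<And>k. k \<in> insert i I \<Longrightarrow> acts_by_endos G (X k) (r k)"
  shows "equivariant_iso G (product_group (insert i I) X) (product_act (insert i I) r)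
    (X i \<times>\<times> product_group I X) (direct_act (r i) (product_act I r))"
  unfolding equivariant_iso_def
proof (intro bexI ballI)
  let ?f = "\<lambda>u. (u i, restrict u I)"
  show "?f \<in> iso (product_group (insert i I) X) (X i \<times>\<times> product_group I X)"
  proof (rule isoI)
    show "?f \<in> hom (product_group (insert i I) X) (X i \<times>\<times> product_group I X)"
      by (rule homI) (use assms(1) in \<open>auto simp: PiE_iff fun_eq_iff\<close>)
    show "bij_betw ?f (carrier (product_group (insert i I) X)) (carrier (X i \<times>\<times> product_group I X))"
      by (rule bij_betw_byWitness[where f' = "\<lambda>(x, u). \<lambda>k\<in>insert i I. if k = i then x else u k"])
        (use assms(1) in \<open>auto simp: PiE_iff fun_eq_iff extensional_def split: if_splits\<close>)
  qed
  show "?f (product_act (insert i I) r g u) = direct_act (r i) (product_act I r) g (?f u)" for g u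
    using assms(1) by (auto simp: product_act_def direct_act_def fun_eq_iff)
qed

lemma card_equivariant_homs_product:
  assumes "finite I" "\<And>i. i \<in> I \<Longrightarrow> acts_by_endos G (X i) (r i)" "acts_by_endos G Y s" "comm_group Y"
  shows "card (equivariant_homs G (product_group I X) (product_act I r) Y s) =
    (\<Prod>i\<in>I. card (equivariant_homs G (X i) (r i) Y s))"
  using assms(1,2)
proof (induction I)
  case empty
  interpret Y: comm_group Y by fact
  \<comment> \<open>The empty product has the everywhere undefined function as its only element, so
    the trivial homomorphism is the only one.\<close>
  have "equivariant_homs G (product_group {} X) (product_act {} r) Y s = {\<lambda>x\<in>{\<lambda>_. undefined}. \<one>\<^bsub>Y\<^esub>}"
  proof (intro equalityI subsetI)
    fix h assume h: "h \<in> equivariant_homs G (product_group {} X) (product_act {} r) Y s"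
    have "h \<one>\<^bsub>product_group {} X\<^esub> = \<one>\<^bsub>Y\<^esub>"
      by (rule hom_one[OF equivariant_homsD(1)[OF h]]) (use Y.is_group product_group[of "{}" X] in auto)
    then show "h \<in> {\<lambda>x\<in>{\<lambda>_. undefined}. \<one>\<^bsub>Y\<^esub>}"
      using equivariant_homsD(2)[OF h] by (auto simp: extensional_def restrict_def simp flip: fun_eq_iff)
  qed (use equivariant_homs_trivial[OF acts_by_endos_product[of "{}" G X r] assms(3)] in auto)
  then show ?case by simp
next
  case (insert i I)
  have I: "acts_by_endos G (product_group I X) (product_act I r)"
    by (rule acts_by_endos_product) (use insert in auto)
  have Ii: "acts_by_endos G (product_group (insert i I) X) (product_act (insert i I) r)"
    by (rule acts_by_endos_product) (use insert in auto)
  have i: "acts_by_endos G (X i) (r i)" using insert by auto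
  have "card (equivariant_homs G (product_group I X) (product_act I r) Y s) =
      (\<Prod>i\<in>I. card (equivariant_homs G (X i) (r i) Y s))"
    by (rule insert.IH) (use insert.prems in auto)
  then show ?case
    using card_equivariant_homs_direct[OF i I assms(3,4)] insert.hyps
      card_equivariant_homs_iso[where Y = Y and s = s, OF
        equivariant_iso_product_insert[OF insert.hyps(2) insert.prems] Ii acts_by_endos_direct[OF i I]]
    by simp
qed

section \<open>Normal subgroups as modules for the conjugation action\<close>

abbreviation normal_homs :: "('g, 'm) monoid_scheme \<Rightarrow> 'g set \<Rightarrow> 'g set \<Rightarrow> ('g \<Rightarrow> 'g) set" where
  "normal_homs G M N \<equiv>
     equivariant_homs G (G\<lparr>carrier := M\<rparr>) (conj_act G) (G\<lparr>carrier := N\<rparr>) (conj_act G)"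

lemma equivariant_endos_eq: "equivariant_endos G A = normal_homs G A A"
  by (simp add: equivariant_endos_def equivariant_homs_def)

context group
begin

lemma normal_group: "N \<lhd> G \<Longrightarrow> group (G\<lparr>carrier := N\<rparr>)"
  by (simp add: normal_imp_subgroup subgroup.subgroup_is_group is_group)

lemma comm_group_normal_iff:
  assumes "N \<lhd> G"
  shows "comm_group (G\<lparr>carrier := N\<rparr>) \<longleftrightarrow> (\<forall>x\<in>N. \<forall>y\<in>N. x \<otimes> y = y \<otimes> x)"
proof
  assume "comm_group (G\<lparr>carrier := N\<rparr>)"
  then show "\<forall>x\<in>N. \<forall>y\<in>N. x \<otimes> y = y \<otimes> x"
    using comm_monoid.m_comm[OF comm_group.axioms(1)] by fastforce
next
  assume "\<forall>x\<in>N. \<forall>y\<in>N. x \<otimes> y = y \<otimes> x"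
  then show "comm_group (G\<lparr>carrier := N\<rparr>)"
    by (intro group.group_comm_groupI[OF normal_group[OF assms]]) simp
qed

lemma conj_act_mult:
  assumes "g \<in> carrier G" "x \<in> carrier G" "y \<in> carrier G"
  shows "conj_act G g (x \<otimes> y) = conj_act G g x \<otimes> conj_act G g y"
proof -
  have "g \<otimes> (inv g \<otimes> (y \<otimes> g)) = y \<otimes> g" using assms by (simp flip: m_assoc)
  then show ?thesis using assms by (simp add: conj_act_def m_assoc)
qed

lemma conj_act_normal: "N \<lhd> G \<Longrightarrow> g \<in> carrier G \<Longrightarrow> x \<in> N \<Longrightarrow> conj_act G g x \<in> N"
  unfolding conj_act_def by (rule normal.inv_op_closed1)

lemma acts_by_endos_normal:
  assumes "N \<lhd> G"
  shows "acts_by_endos G (G\<lparr>carrier := N\<rparr>) (conj_act G)"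
  unfolding acts_by_endos_def
proof (intro conjI ballI homI)
  fix g x y
  assume "g \<in> carrier G" "x \<in> carrier (G\<lparr>carrier := N\<rparr>)" "y \<in> carrier (G\<lparr>carrier := N\<rparr>)"
  then show "conj_act G g (x \<otimes>\<^bsub>G\<lparr>carrier := N\<rparr>\<^esub> y) =
      conj_act G g x \<otimes>\<^bsub>G\<lparr>carrier := N\<rparr>\<^esub> conj_act G g y"
    using conj_act_mult normal_mem_carrier[OF assms] by simp
qed (use normal_group[OF assms] conj_act_normal[OF assms] in auto)

lemma normal_conj_actI:
  assumes "subgroup N G" "\<And>g x. g \<in> carrier G \<Longrightarrow> x \<in> N \<Longrightarrow> conj_act G g x \<in> N"
  shows "N \<lhd> G"
proof (rule normal_invI[OF assms(1)])
  fix g x assume "g \<in> carrier G" "x \<in> N"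
  then show "g \<otimes> x \<otimes> inv g \<in> N"
    \<comment> \<open>The action is conjugation with the inverse on the left, the criterion has it
      on the right; \<open>inv g\<close> exchanges the two.\<close>
    using assms(2)[of "inv g" x] by (simp add: conj_act_def)
qed

section \<open>Kernels, images and Schur's lemma\<close>

lemma normal_homsD:
  assumes "f \<in> normal_homs G M N"
  shows "f \<in> extensional M"
    and "x \<in> M \<Longrightarrow> f x \<in> N"
    and "x \<in> M \<Longrightarrow> y \<in> M \<Longrightarrow> f (x \<otimes> y) = f x \<otimes> f y"
    and "g \<in> carrier G \<Longrightarrow> x \<in> M \<Longrightarrow> f (conj_act G g x) = conj_act G g (f x)"
  using equivariant_homsD[OF assms] by auto

lemma normal_homs_one:
  assumes "f \<in> normal_homs G M N" "M \<lhd> G" "N \<lhd> G"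
  shows "f \<one> = \<one>"
  using hom_one[OF equivariant_homsD(1)[OF assms(1)]] assms(2,3) normal_group by simp

lemma normal_homs_inv:
  assumes "f \<in> normal_homs G M N" "M \<lhd> G" "N \<lhd> G" "x \<in> M"
  shows "f (inv x) = inv (f x)"
proof -
  have "f (inv x) \<otimes> f x = \<one>"
    using normal_homsD(3)[OF assms(1), of "inv x" x] assms normal_inv_closed normal_mem_carrier
      normal_homs_one by (metis l_inv)
  then show ?thesis
    using assms normal_homsD(2) normal_inv_closed normal_mem_carrier inv_equality by metis
qed

lemma normal_homs_restrict:
  assumes "f \<in> normal_homs G T A" "M \<lhd> G" "M \<subseteq> T"
  shows "restrict f M \<in> normal_homs G M A"
  using equivariant_homsI[where X = "G\<lparr>carrier := M\<rparr>" and Y = "G\<lparr>carrier := A\<rparr>"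
      and f = f and r = "conj_act G" and s = "conj_act G" and G = G]
    acts_by_endos_normal[OF assms(2)] normal_homsD[OF assms(1)] assms(3) by (simp add: subset_iff)

text \<open>The kernel is normal in the whole group, not only in \<open>M\<close>, because
  \<open>f\<close> commutes with conjugation by every element. The same holds for the image
  below.\<close>

lemma normal_homs_kernel:
  assumes "f \<in> normal_homs G M N" "M \<lhd> G" "N \<lhd> G"
  shows "{x \<in> M. f x = \<one>} \<lhd> G"
proof (rule normal_conj_actI)
  show "subgroup {x \<in> M. f x = \<one>} G"
  proof (rule subgroupI)
    show "{x \<in> M. f x = \<one>} \<subseteq> carrier G" using normal_mem_carrier[OF assms(2)] by blast
    show "{x \<in> M. f x = \<one>} \<noteq> {}"
      using one_in_normal[OF assms(2)] normal_homs_one[OF assms] by blast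
    show "inv x \<in> {x \<in> M. f x = \<one>}" if "x \<in> {x \<in> M. f x = \<one>}" for x
      using that normal_homs_inv[OF assms, of x] normal_inv_closed[OF assms(2)] by simp
    show "x \<otimes> y \<in> {x \<in> M. f x = \<one>}"
      if "x \<in> {x \<in> M. f x = \<one>}" "y \<in> {x \<in> M. f x = \<one>}" for x y
      using that normal_homsD(3)[OF assms(1), of x y] normal_m_closed[OF assms(2)] by simp
  qed
  show "conj_act G g x \<in> {x \<in> M. f x = \<one>}" if "g \<in> carrier G" "x \<in> {x \<in> M. f x = \<one>}" for g x
    using that normal_homsD[OF assms(1)] conj_act_normal[OF assms(2)] by (simp add: conj_act_def)
qed

lemma normal_homs_image:
  assumes "f \<in> normal_homs G M N" "M \<lhd> G" "N \<lhd> G"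
  shows "f ` M \<lhd> G"
proof (rule normal_conj_actI)
  note f = normal_homsD[OF assms(1)]
  show "subgroup (f ` M) G"
  proof (rule subgroupI)
    show "f ` M \<subseteq> carrier G" using f(2) normal_mem_carrier[OF assms(3)] by blast
    show "f ` M \<noteq> {}" using one_in_normal[OF assms(2)] by blast
    show "inv a \<in> f ` M" if "a \<in> f ` M" for a
      using that normal_homs_inv[OF assms, symmetric] normal_inv_closed[OF assms(2)] by auto
    show "a \<otimes> b \<in> f ` M" if "a \<in> f ` M" "b \<in> f ` M" for a b
      using that f(3)[symmetric] normal_m_closed[OF assms(2)] by auto
  qed
  show "conj_act G g x \<in> f ` M" if "g \<in> carrier G" "x \<in> f ` M" for g x
    using that f(4)[symmetric] conj_act_normal[OF assms(2)] by auto
qed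

text \<open>Schur's lemma, for Abelian and non-Abelian minimal normal subgroups alike. Kernel and
  image are normal, so by minimality a nontrivial map has trivial kernel and full image, that is, it
  is an equivariant isomorphism.\<close>

lemma schur:
  assumes M: "minimal_normal G M" and N: "minimal_normal G N" and "\<not> subgroups_iso G M N"
  shows "card (normal_homs G M N) = 1"
proof -
  have n: "M \<lhd> G" "N \<lhd> G" using M N by (auto simp: minimal_normal_def)
  have "f = (\<lambda>x\<in>M. \<one>)" if f: "f \<in> normal_homs G M N" for f
  proof (rule ccontr)
    assume nt: "f \<noteq> (\<lambda>x\<in>M. \<one>)"
    then obtain x where x: "x \<in> M" "f x \<noteq> \<one>"
      using normal_homsD(1)[OF f] by (metis extensionalityI restrict_apply restrict_extensional)
    have "{x \<in> M. f x = \<one>} = {\<one>} \<or> {x \<in> M. f x = \<one>} = M"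
      using M normal_homs_kernel[OF f n] by (simp add: minimal_normal_def)
    then have ker: "{x \<in> M. f x = \<one>} = {\<one>}" using x by auto
    have "f ` M = {\<one>} \<or> f ` M = N"
      using N normal_homs_image[OF f n] normal_homsD(2)[OF f] by (auto simp: minimal_normal_def)
    then have im: "f ` M = N" using x by auto
    have "inj_on f M"
    proof (rule inj_onI)
      fix a b assume ab: "a \<in> M" "b \<in> M" "f a = f b"
      have "f (a \<otimes> inv b) = f a \<otimes> inv (f b)"
        using normal_homsD(3)[OF f] normal_homs_inv[OF f n] normal_inv_closed[OF n(1)] ab by simp
      also have "\<dots> = \<one>"
        using ab normal_homsD(2)[OF f] normal_mem_carrier[OF n(2)] by simp
      finally have "a \<otimes> inv b \<in> {\<one>}"
        using ab normal_inv_closed[OF n(1)] normal_m_closed[OF n(1)] unfolding ker[symmetric] by simp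
      then show "a = b"
        using ab normal_mem_carrier[OF n(1)] inv_solve_right' by simp
    qed
    then have "f \<in> iso (G\<lparr>carrier := M\<rparr>) (G\<lparr>carrier := N\<rparr>)"
      using equivariant_homsD(1)[OF f] im by (auto intro: isoI simp: bij_betw_def)
    then have "subgroups_iso G M N"
      unfolding subgroups_iso_def equivariant_iso_def using normal_homsD(4)[OF f] by auto
    then show False using assms by simp
  qed
  moreover have "(\<lambda>x\<in>M. \<one>) \<in> normal_homs G M N"
    using equivariant_homs_trivial[OF acts_by_endos_normal[OF n(1)] acts_by_endos_normal[OF n(2)]]
    by simp
  ultimately have "normal_homs G M N = {\<lambda>x\<in>M. \<one>}" by blast
  then show ?thesis by simp
qed

section \<open>Homomorphisms on an internal direct product\<close>

lemma complements_decomp: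
  assumes "N \<in> complements M T" "M \<lhd> G" "t \<in> T"
  obtains m n where "m \<in> M" "n \<in> N" "t = m \<otimes> n"
proof -
  have "N <#> M = M <#> N"
    using assms commut_normal normal_imp_subgroup by (auto simp: complements_def)
  then have "t \<in> M <#> N" using assms by (auto simp: complements_def)
  then show ?thesis using that by (auto simp: set_mult_def)
qed

text \<open>\<open>T\<close> as an internal direct product, element by element. Normal subgroups
  that meet trivially centralize each other; hence the factors may be written in the order
  \<open>m\<close>, \<open>n\<close>, although \<open>complements\<close> puts \<open>N\<close>
  first.\<close>

lemma complementsD:
  assumes "N \<in> complements M T" "M \<lhd> G"
  shows "N \<lhd> G" "N \<inter> M = {\<one>}" "N \<subseteq> T" "M \<subseteq> T"
    and "m \<in> M \<Longrightarrow> n \<in> N \<Longrightarrow> m \<otimes> n \<in> T"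
    and "m \<in> M \<Longrightarrow> n \<in> N \<Longrightarrow> m \<otimes> n = n \<otimes> m"
    and "m \<in> M \<Longrightarrow> n \<in> N \<Longrightarrow> m' \<in> M \<Longrightarrow> n' \<in> N \<Longrightarrow> m \<otimes> n = m' \<otimes> n' \<Longrightarrow> m = m' \<and> n = n'"
proof -
  show N: "N \<lhd> G" and NM: "N \<inter> M = {\<one>}" and "N \<subseteq> T" "M \<subseteq> T"
    using assms set_mult_upper[OF _ assms(2)] by (auto simp: complements_def)
  have MN: "M \<inter> N \<subseteq> {\<one>}" using NM by auto
  show c: "m \<otimes> n = n \<otimes> m" if "m \<in> M" "n \<in> N" for m n
    by (rule normal_imp_commuting[OF assms(2) N MN that])
  show "m \<otimes> n \<in> T" if "m \<in> M" "n \<in> N"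
    using assms(1) c[OF that] that by (auto simp: complements_def set_mult_def)
  \<comment> \<open>This locale supplies the uniqueness of the decomposition, by its fact
    \<open>cancel\<close>.\<close>
  interpret group_disjoint_sum G M N
    using assms(2) N by (auto simp: group_disjoint_sum_def normal_def)
  show "m = m' \<and> n = n'" if "m \<in> M" "n \<in> N" "m' \<in> M" "n' \<in> N" "m \<otimes> n = m' \<otimes> n'"
    using cancel MN that by blast
qed

lemma normal_homs_complement_ext:
  assumes N: "N \<in> complements M T" and M: "M \<lhd> G"
    and f: "f \<in> normal_homs G T A" and f': "f' \<in> normal_homs G T A"
    and eq: "\<And>x. x \<in> M \<Longrightarrow> f x = f' x" "\<And>x. x \<in> N \<Longrightarrow> f x = f' x"
  shows "f = f'"
proof (rule extensionalityI[OF normal_homsD(1)[OF f] normal_homsD(1)[OF f']])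
  fix t assume "t \<in> T"
  then obtain m n where mn: "m \<in> M" "n \<in> N" "t = m \<otimes> n"
    using complements_decomp[OF N M] by blast
  then have "m \<in> T" "n \<in> T" using complementsD(3,4)[OF N M] by auto
  then show "f t = f' t"
    using eq mn normal_homsD(3)[OF f, of m n] normal_homsD(3)[OF f', of m n] by simp
qed

text \<open>The extension sends \<open>m \<otimes> n\<close> to \<open>g m \<otimes> h n\<close>. It
  is multiplicative because \<open>M\<close> and \<open>N\<close> centralize each other and
  \<open>A\<close> is Abelian.\<close>

lemma normal_homs_complement_extend:
  assumes N: "N \<in> complements M T" and M: "M \<lhd> G" and T: "T \<lhd> G" and A: "A \<lhd> G"
    and comm: "comm_group (G\<lparr>carrier := A\<rparr>)"
    and g: "g \<in> normal_homs G M A" and h: "h \<in> normal_homs G N A"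
  obtains f where "f \<in> normal_homs G T A" "\<And>x. x \<in> M \<Longrightarrow> f x = g x" "\<And>x. x \<in> N \<Longrightarrow> f x = h x"
proof -
  note NM = complementsD[OF N M]
  note g' = normal_homsD[OF g] and h' = normal_homsD[OF h]
  note car = normal_mem_carrier[OF M] normal_mem_carrier[OF NM(1)] normal_mem_carrier[OF A]
  have Acomm: "x \<otimes> y = y \<otimes> x" if "x \<in> A" "y \<in> A" for x y
    using comm that comm_group_normal_iff[OF A] by blast
  have "\<forall>t\<in>T. \<exists>m n. m \<in> M \<and> n \<in> N \<and> t = m \<otimes> n"
    using complements_decomp[OF N M] by metis
  \<comment> \<open>These are the projections of \<open>T\<close> to \<open>M\<close> and
    \<open>N\<close>. Uniqueness of the decomposition turns the choice into the formula
    \<open>fmn\<close>.\<close>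
  then obtain p r where pr: "\<And>t. t \<in> T \<Longrightarrow> p t \<in> M \<and> r t \<in> N \<and> t = p t \<otimes> r t"
    by metis
  define f where "f t = g (p t) \<otimes> h (r t)" for t
  have fmn: "f (m \<otimes> n) = g m \<otimes> h n" if "m \<in> M" "n \<in> N" for m n
    using that pr[OF NM(5)[OF that]] NM(7)[OF that] unfolding f_def by metis
  have f_A: "f t \<in> A" if "t \<in> T" for t
    unfolding f_def using pr[OF that] g'(2) h'(2) normal_m_closed[OF A] by blast
  have "restrict f (carrier (G\<lparr>carrier := T\<rparr>)) \<in> normal_homs G T A"
  proof (rule equivariant_homsI[OF _ _ _ acts_by_endos_normal[OF T]])
    fix x y assume "x \<in> carrier (G\<lparr>carrier := T\<rparr>)" "y \<in> carrier (G\<lparr>carrier := T\<rparr>)"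
    then obtain m n m' n' where x: "m \<in> M" "n \<in> N" "x = m \<otimes> n" and y: "m' \<in> M" "n' \<in> N" "y = m' \<otimes> n'"
      using pr by (metis partial_object.select_convs(1) partial_object.surjective partial_object.update_convs(1))
    have "x \<otimes> y = m \<otimes> (n \<otimes> m') \<otimes> n'"
      using x y car by (simp add: m_assoc)
    also have "\<dots> = m \<otimes> (m' \<otimes> n) \<otimes> n'"
      using x y NM(6)[of m' n] by simp
    also have "\<dots> = (m \<otimes> m') \<otimes> (n \<otimes> n')"
      using x y car by (simp add: m_assoc)
    finally have "f (x \<otimes> y) = (g m \<otimes> g m') \<otimes> (h n \<otimes> h n')"
      using fmn x y g'(3) h'(3) normal_m_closed[OF M] normal_m_closed[OF NM(1)] by simp
    also have "\<dots> = g m \<otimes> (g m' \<otimes> h n) \<otimes> h n'"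
      using x y car g'(2) h'(2) by (simp add: m_assoc)
    also have "\<dots> = g m \<otimes> (h n \<otimes> g m') \<otimes> h n'"
      using x y g'(2) h'(2) Acomm[of "g m'" "h n"] by simp
    also have "\<dots> = (g m \<otimes> h n) \<otimes> (g m' \<otimes> h n')"
      using x y car g'(2) h'(2) by (simp add: m_assoc)
    finally show "f (x \<otimes>\<^bsub>G\<lparr>carrier := T\<rparr>\<^esub> y) = f x \<otimes>\<^bsub>G\<lparr>carrier := A\<rparr>\<^esub> f y"
      using fmn x y by simp
  next
    fix c x assume c: "c \<in> carrier G" and "x \<in> carrier (G\<lparr>carrier := T\<rparr>)"
    then obtain m n where x: "m \<in> M" "n \<in> N" "x = m \<otimes> n" using pr by fastforce
    then show "f (conj_act G c x) = conj_act G c (f x)"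
      using c car fmn conj_act_mult conj_act_normal[OF M] conj_act_normal[OF NM(1)] g'(2,4) h'(2,4)
      by simp
  qed (use f_A in simp)
  moreover have "f x = g x" if "x \<in> M" for x
    using fmn[OF that one_in_normal[OF NM(1)]] that car normal_homs_one[OF h NM(1) A] g'(2) by simp
  moreover have "f x = h x" if "x \<in> N" for x
    using fmn[OF one_in_normal[OF M] that] that car normal_homs_one[OF g M A] h'(2) by simp
  ultimately show ?thesis using NM(3,4) by (intro that[of "restrict f T"]) auto
qed

text \<open>Restriction to the two factors is a bijection. This multiplicativity is how the
  exponents pass from \<open>T\<close> to a complement in the induction.\<close>

lemma card_normal_homs_complement:
  assumes N: "N \<in> complements M T" and M: "M \<lhd> G" and T: "T \<lhd> G" and A: "A \<lhd> G"
    and comm: "comm_group (G\<lparr>carrier := A\<rparr>)"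
  shows "card (normal_homs G T A) = card (normal_homs G M A) * card (normal_homs G N A)"
proof -
  note NM = complementsD[OF N M]
  have "bij_betw (\<lambda>f. (restrict f M, restrict f N)) (normal_homs G T A)
      (normal_homs G M A \<times> normal_homs G N A)"
  proof (intro bij_betw_imageI inj_onI equalityI subsetI)
    fix f f' assume "f \<in> normal_homs G T A" "f' \<in> normal_homs G T A"
      and "(restrict f M, restrict f N) = (restrict f' M, restrict f' N)"
    then show "f = f'"
      by (intro normal_homs_complement_ext[OF N M]) (auto simp: restrict_def fun_eq_iff, metis+)
  next
    fix z assume "z \<in> (\<lambda>f. (restrict f M, restrict f N)) ` normal_homs G T A"
    then show "z \<in> normal_homs G M A \<times> normal_homs G N A"
      using normal_homs_restrict NM(1,3,4) M by auto
  next
    fix z assume "z \<in> normal_homs G M A \<times> normal_homs G N A"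
    then obtain g h where z: "z = (g, h)" "g \<in> normal_homs G M A" "h \<in> normal_homs G N A" by auto
    then obtain f where f: "f \<in> normal_homs G T A"
      "\<And>x. x \<in> M \<Longrightarrow> f x = g x" "\<And>x. x \<in> N \<Longrightarrow> f x = h x"
      using normal_homs_complement_extend[OF N M T A comm] by blast
    have "restrict f M = g"
      using f(2) normal_homsD(1)[OF z(2)] by (auto intro: extensionalityI[of _ M])
    moreover have "restrict f N = h"
      using f(3) normal_homsD(1)[OF z(3)] by (auto intro: extensionalityI[of _ N])
    ultimately show "z \<in> (\<lambda>f. (restrict f M, restrict f N)) ` normal_homs G T A"
      using f(1) z(1) by blast
  qed
  from bij_betw_same_card[OF this] show ?thesis by (simp add: card_cartesian_product)
qed

end

section \<open>Complements of Abelian and of non-Abelian minimal normal subgroups\<close>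

context group
begin

text \<open>
  Fix an isomorphism \<open>\<phi>\<close> from \<open>M\<close> to \<open>A\<close>.  Extensions of \<open>\<phi>\<close> to \<open>T\<close> correspond to complements of \<open>M\<close>
  by taking kernels, and to homomorphisms \<open>N \<rightarrow> A\<close> by restriction.
\<close>

lemma card_complements_abelian:
  assumes M: "M \<lhd> G" and T: "T \<lhd> G" and A: "A \<lhd> G"
    and comm: "comm_group (G\<lparr>carrier := A\<rparr>)" and iso: "subgroups_iso G M A"
    and N: "N \<in> complements M T"
  shows "card (complements M T) = card (normal_homs G N A)"
proof -
  note NM = complementsD[OF N M]
  obtain \<phi>' where \<phi>': "\<phi>' \<in> iso (G\<lparr>carrier := M\<rparr>) (G\<lparr>carrier := A\<rparr>)"
    and eq: "\<forall>g\<in>carrier G. \<forall>x\<in>M. \<phi>' (conj_act G g x) = conj_act G g (\<phi>' x)"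
    using iso by (auto simp: subgroups_iso_def equivariant_iso_def)
  \<comment> \<open>The isomorphism is made extensional so that it is a member of
    \<open>normal_homs G M A\<close>.\<close>
  define \<phi> where "\<phi> = restrict \<phi>' M"
  have bij: "bij_betw \<phi> M A"
    using \<phi>' bij_betw_cong[of M \<phi> \<phi>' A] by (simp add: \<phi>_def iso_def)
  have \<phi>: "\<phi> \<in> normal_homs G M A"
    unfolding \<phi>_def using \<phi>' eq
      equivariant_homsI[where X = "G\<lparr>carrier := M\<rparr>" and Y = "G\<lparr>carrier := A\<rparr>"
        and f = \<phi>' and r = "conj_act G" and s = "conj_act G" and G = G, OF _ _ _ acts_by_endos_normal[OF M]]
    by (auto simp: iso_def hom_def)
  have \<phi>1: "\<phi> \<one> = \<one>" by (rule normal_homs_one[OF \<phi> M A])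
  have \<phi>_inj: "x = \<one>" if "x \<in> M" "\<phi> x = \<one>" for x
    using bij that \<phi>1 one_in_normal[OF M] by (auto simp: bij_betw_def inj_on_def)
  define E where "E = {f \<in> normal_homs G T A. \<forall>x\<in>M. f x = \<phi> x}"
  define ker where "ker = (\<lambda>f. {x \<in> T. f x = \<one>})"
  have triv: "(\<lambda>x\<in>K. \<one>) \<in> normal_homs G K A" if "K \<lhd> G" for K
    using equivariant_homs_trivial[OF acts_by_endos_normal[OF that] acts_by_endos_normal[OF A]] by simp
  have "bij_betw (\<lambda>f. restrict f N) E (normal_homs G N A)"
  proof (intro bij_betw_imageI inj_onI equalityI subsetI)
    fix f f' assume f: "f \<in> E" "f' \<in> E" and r: "restrict f N = restrict f' N"
    have "f x = f' x" if "x \<in> N" for x using r that by (metis restrict_apply')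
    then show "f = f'"
      using f by (intro normal_homs_complement_ext[OF N M]) (auto simp: E_def)
  next
    fix h assume "h \<in> (\<lambda>f. restrict f N) ` E"
    then show "h \<in> normal_homs G N A" using normal_homs_restrict NM(1,3) by (auto simp: E_def)
  next
    fix h assume h: "h \<in> normal_homs G N A"
    obtain f where f: "f \<in> normal_homs G T A" "\<And>x. x \<in> M \<Longrightarrow> f x = \<phi> x" "\<And>x. x \<in> N \<Longrightarrow> f x = h x"
      using normal_homs_complement_extend[OF N M T A comm \<phi> h] by blast
    have "restrict f N = h"
      using f(3) normal_homsD(1)[OF h] by (auto intro: extensionalityI[of _ N])
    moreover have "f \<in> E" using f by (simp add: E_def)
    ultimately show "h \<in> (\<lambda>f. restrict f N) ` E" by blast
  qed
  then have "card E = card (normal_homs G N A)" by (rule bij_betw_same_card)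
  moreover have ker_compl: "ker f \<in> complements M T" if "f \<in> E" for f
  proof -
    have f: "f \<in> normal_homs G T A" and fM: "\<And>x. x \<in> M \<Longrightarrow> f x = \<phi> x"
      using that by (auto simp: E_def)
    have k: "ker f \<lhd> G" unfolding ker_def by (rule normal_homs_kernel[OF f T A])
    have "ker f \<inter> M \<subseteq> {\<one>}" using fM \<phi>_inj by (auto simp: ker_def)
    then have int: "ker f \<inter> M = {\<one>}" using one_in_normal[OF k] one_in_normal[OF M] by auto
    have "T \<subseteq> ker f <#> M"
    proof
      fix t assume t: "t \<in> T"
      then have "f t \<in> A" by (rule normal_homsD(2)[OF f])
      \<comment> \<open>Since \<phi> is onto \<open>A\<close>, the value of \<open>f\<close> at
        \<open>t\<close> is already attained at some \<open>m\<close> in \<open>M\<close>. Dividing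
        \<open>t\<close> by \<open>m\<close> gives an element of the kernel.\<close>
      then obtain m where m: "m \<in> M" "\<phi> m = f t" using bij by (auto simp: bij_betw_def)
      have mT: "inv m \<in> T" using m NM(4) normal_inv_closed[OF M] by blast
      have "f (inv m) = inv (f m)" using normal_homs_inv[OF f T A] m NM(4) by blast
      then have "f (t \<otimes> inv m) = f t \<otimes> inv (f t)"
        using normal_homsD(3)[OF f t mT] fM m by simp
      then have "t \<otimes> inv m \<in> ker f"
        using t mT normal_m_closed[OF T] \<open>f t \<in> A\<close> normal_mem_carrier[OF A] by (simp add: ker_def)
      moreover have "t = (t \<otimes> inv m) \<otimes> m"
        using t m normal_mem_carrier T M by (simp add: m_assoc)
      ultimately show "t \<in> ker f <#> M" using m by (auto simp: set_mult_def)
    qed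
    moreover have "ker f <#> M \<subseteq> T"
      by (rule set_mult_least[OF T _ NM(4)]) (simp add: ker_def)
    ultimately show ?thesis using k int by (simp add: complements_def)
  qed
  have "bij_betw ker E (complements M T)"
  proof (intro bij_betw_imageI inj_onI equalityI subsetI)
    fix f f' assume f: "f \<in> E" "f' \<in> E" and k: "ker f = ker f'"
    show "f = f'"
    \<comment> \<open>Both maps are trivial on the common kernel and equal \<phi> on
      \<open>M\<close>; the kernel is a complement of \<open>M\<close>, so they agree on
      \<open>T\<close>.\<close>
    proof (rule normal_homs_complement_ext[OF ker_compl[OF f(1)] M])
      show "f x = f' x" if "x \<in> ker f" for x
      proof -
        have "x \<in> ker f'" using that k by simp
        then show ?thesis using that by (simp add: ker_def)
      qed
    qed (use f in \<open>auto simp: E_def\<close>)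
  next
    fix K assume "K \<in> ker ` E"
    then show "K \<in> complements M T" using ker_compl by blast
  next
    fix K assume K: "K \<in> complements M T"
    note KM = complementsD[OF K M]
    \<comment> \<open>A given complement \<open>K\<close> is the kernel of the extension of \<phi>
      that is trivial on \<open>K\<close>.\<close>
    obtain f where f: "f \<in> normal_homs G T A" "\<And>x. x \<in> M \<Longrightarrow> f x = \<phi> x" "\<And>x. x \<in> K \<Longrightarrow> f x = \<one>"
      using normal_homs_complement_extend[OF K M T A comm \<phi> triv[OF KM(1)]] by (metis restrict_apply')
    have "ker f = K"
    proof (intro equalityI subsetI)
      fix t assume t: "t \<in> ker f"
      then obtain m k where mk: "m \<in> M" "k \<in> K" "t = m \<otimes> k"
        using complements_decomp[OF K M] by (auto simp: ker_def)
      have "f t = f m \<otimes> f k" using mk KM(3,4) normal_homsD(3)[OF f(1), of m k] by auto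
      then have "\<phi> m = \<one>"
        using mk f t normal_homsD(2)[OF \<phi>] normal_mem_carrier[OF A] by (simp add: ker_def)
      then have "m = \<one>" by (rule \<phi>_inj[OF mk(1)])
      then show "t \<in> K" using mk normal_mem_carrier[OF KM(1)] by simp
    qed (use f KM in \<open>auto simp: ker_def\<close>)
    moreover have "f \<in> E" using f by (simp add: E_def)
    ultimately show "K \<in> ker ` E" by blast
  qed
  then have "card E = card (complements M T)" by (rule bij_betw_same_card)
  ultimately show ?thesis by simp
qed

text \<open>The centre of \<open>M\<close> is normal in the whole group. By minimality it is trivial
  or all of \<open>M\<close>, and the latter would make \<open>M\<close> commutative.\<close>

lemma minimal_normal_center:
  assumes M: "minimal_normal G M" and nc: "\<not> comm_group (G\<lparr>carrier := M\<rparr>)"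
    and x: "x \<in> M" "\<And>y. y \<in> M \<Longrightarrow> x \<otimes> y = y \<otimes> x"
  shows "x = \<one>"
proof -
  have Mn: "M \<lhd> G" using M by (simp add: minimal_normal_def)
  note car = normal_mem_carrier[OF Mn]
  let ?Z = "{x \<in> M. \<forall>y\<in>M. x \<otimes> y = y \<otimes> x}"
  have "?Z \<lhd> G"
  proof (rule normal_conj_actI)
    show "subgroup ?Z G"
    proof (rule subgroupI)
      show "?Z \<subseteq> carrier G" using car by blast
      show "?Z \<noteq> {}" using one_in_normal[OF Mn] car by force
      show "inv a \<in> ?Z" if "a \<in> ?Z" for a
      proof -
        have "inv a \<otimes> y = y \<otimes> inv a" if "y \<in> M" for y
        proof -
          have "a \<otimes> y = y \<otimes> a" "a \<in> carrier G" "y \<in> carrier G" using \<open>a \<in> ?Z\<close> that car by auto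
          then show ?thesis by (metis inv_closed inv_solve_left inv_solve_right m_assoc m_closed)
        qed
        then show ?thesis using that normal_inv_closed[OF Mn] by auto
      qed
      show "a \<otimes> b \<in> ?Z" if "a \<in> ?Z" "b \<in> ?Z" for a b
      proof -
        have "a \<otimes> b \<otimes> y = y \<otimes> (a \<otimes> b)" if "y \<in> M" for y
        proof -
          have ab: "a \<otimes> y = y \<otimes> a" "b \<otimes> y = y \<otimes> b" "a \<in> carrier G" "b \<in> carrier G" "y \<in> carrier G"
            using \<open>a \<in> ?Z\<close> \<open>b \<in> ?Z\<close> that car by auto
          have "a \<otimes> b \<otimes> y = a \<otimes> (y \<otimes> b)" using ab(2-5) by (simp add: m_assoc)
          also have "\<dots> = (a \<otimes> y) \<otimes> b" using ab(3-5) by (simp add: m_assoc)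
          also have "\<dots> = y \<otimes> (a \<otimes> b)" unfolding ab(1) using ab(3-5) by (simp add: m_assoc)
          finally show ?thesis .
        qed
        moreover have "a \<otimes> b \<in> M" using that normal_m_closed[OF Mn] by blast
        ultimately show ?thesis by blast
      qed
    qed
    show "conj_act G g z \<in> ?Z" if g: "g \<in> carrier G" and z: "z \<in> ?Z" for g z
    proof -
      have "conj_act G g z \<otimes> y = y \<otimes> conj_act G g z" if y: "y \<in> M" for y
      proof -
        \<comment> \<open>Every \<open>y\<close> in \<open>M\<close> is the conjugate by
          \<open>g\<close> of an element of \<open>M\<close>; so conjugating the relation for
          \<open>z\<close> yields the one for its conjugate.\<close>
        have y': "conj_act G (inv g) y \<in> M" by (rule conj_act_normal[OF Mn _ y]) (use g in simp)
        have yy: "conj_act G g (conj_act G (inv g) y) = y"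
          using g car[OF y] by (simp add: conj_act_def m_assoc inv_solve_left')
        have zM: "z \<in> M" and "z \<otimes> conj_act G (inv g) y = conj_act G (inv g) y \<otimes> z"
          using z y' by blast+
        then have "conj_act G g z \<otimes> conj_act G g (conj_act G (inv g) y) =
            conj_act G g (conj_act G (inv g) y) \<otimes> conj_act G g z"
          using conj_act_mult[OF g car[OF zM] car[OF y']] conj_act_mult[OF g car[OF y'] car[OF zM]]
          by simp
        then show ?thesis unfolding yy .
      qed
      moreover have "conj_act G g z \<in> M" using z conj_act_normal[OF Mn g] by blast
      ultimately show ?thesis by blast
    qed
  qed
  then have "?Z = {\<one>} \<or> ?Z = M" using M by (simp add: minimal_normal_def)
  moreover have "?Z \<noteq> M"
  proof
    assume "?Z = M"
    then have "\<forall>x\<in>M. \<forall>y\<in>M. x \<otimes> y = y \<otimes> x" by blast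
    then show False using nc comm_group_normal_iff[OF Mn] by blast
  qed
  ultimately show ?thesis using x by blast
qed

text \<open>Both complements centralize \<open>M\<close>. If \<open>k = m \<otimes> n\<close> with
  \<open>k\<close> in one and \<open>n\<close> in the other, then \<open>m\<close> is central in
  \<open>M\<close>, hence trivial, and \<open>k = n\<close>. Symmetry gives equality.\<close>

lemma complement_nonabelian_unique:
  assumes M: "minimal_normal G M" and nc: "\<not> comm_group (G\<lparr>carrier := M\<rparr>)"
    and N: "N \<in> complements M T" and K: "K \<in> complements M T"
  shows "K = N"
proof -
  have Mn: "M \<lhd> G" using M by (simp add: minimal_normal_def)
  have "K \<subseteq> N" if N: "N \<in> complements M T" and K: "K \<in> complements M T" for N K
  proof
    note NM = complementsD[OF N Mn] and KM = complementsD[OF K Mn]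
    note car = normal_mem_carrier[OF Mn] normal_mem_carrier[OF NM(1)] normal_mem_carrier[OF KM(1)]
    fix k assume k: "k \<in> K"
    then obtain m n where mn: "m \<in> M" "n \<in> N" "k = m \<otimes> n"
      using complements_decomp[OF N Mn] KM(3) by blast
    have "m \<otimes> y = y \<otimes> m" if y: "y \<in> M" for y
    proof -
      have "(m \<otimes> y) \<otimes> n = m \<otimes> (n \<otimes> y)"
        using car mn y NM(6)[of y n] by (simp add: m_assoc)
      also have "\<dots> = y \<otimes> (m \<otimes> n)"
        using car mn y KM(6)[OF y k] by (simp add: m_assoc)
      finally have "(m \<otimes> y) \<otimes> n = (y \<otimes> m) \<otimes> n"
        using car mn y by (simp add: m_assoc)
      then show ?thesis using car mn y by simp
    qed
    then have "m = \<one>" using minimal_normal_center[OF M nc mn(1)] by blast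
    then show "k \<in> N" using mn car by simp
  qed
  then show ?thesis using N K by blast
qed

text \<open>Passing from \<open>T\<close> to a complement of \<open>M\<close> thus loses no
  non-Abelian minimal normal subgroup except possibly \<open>M\<close> itself. This controls the
  sign in the formula.\<close>

lemma nonabelian_minimal_in_complement:
  assumes M: "minimal_normal G M" and N: "N \<in> complements M T"
    and K: "K \<in> nonabelian_minimal_normals G" "K \<subseteq> T" "K \<noteq> M"
  shows "K \<subseteq> N"
proof (rule ccontr)
  assume nKN: "\<not> K \<subseteq> N"
  have Km: "minimal_normal G K" and Knc: "\<not> comm_group (G\<lparr>carrier := K\<rparr>)"
    using K(1) by (auto simp: nonabelian_minimal_normals_def)
  have Mn: "M \<lhd> G" and Kn: "K \<lhd> G" using M Km by (auto simp: minimal_normal_def)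
  note NM = complementsD[OF N Mn]
  have "K \<noteq> {\<one>}" using Km by (simp add: minimal_normal_def)
  then have "\<not> K \<subseteq> M" using M Kn K(3) by (auto simp: minimal_normal_def)
  then have KM: "M \<inter> K \<subseteq> {\<one>}" using minimal_normal_Int[OF Km Mn] by simp
  have KN: "N \<inter> K \<subseteq> {\<one>}" using minimal_normal_Int[OF Km NM(1) nKN] by simp
  \<comment> \<open>\<open>K\<close> meets both \<open>M\<close> and \<open>N\<close> trivially, hence centralizes \<open>T = M N\<close> and thus itself\<close>
  have "x \<otimes> y = y \<otimes> x" if x: "x \<in> K" and y: "y \<in> K" for x y
  proof -
    obtain m n where mn: "m \<in> M" "n \<in> N" "x = m \<otimes> n"
      using complements_decomp[OF N Mn] x K(2) by blast
    note car = normal_mem_carrier[OF Mn mn(1)] normal_mem_carrier[OF NM(1) mn(2)]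
      normal_mem_carrier[OF Kn y]
    have "x \<otimes> y = m \<otimes> (y \<otimes> n)"
      using mn car normal_imp_commuting[OF NM(1) Kn KN mn(2) y] by (simp add: m_assoc)
    also have "\<dots> = (y \<otimes> m) \<otimes> n"
      using car normal_imp_commuting[OF Mn Kn KM mn(1) y] by (simp flip: m_assoc)
    finally show ?thesis using mn car by (simp add: m_assoc)
  qed
  then show False using Knc comm_group_normal_iff[OF Kn] by blast
qed

text \<open>For a prime \<open>p\<close> dividing the order of some element, the elements of
  \<open>M\<close> killed by \<open>p\<close> form a nontrivial normal subgroup of the whole group,
  which is \<open>M\<close> by minimality. So every minimal normal subgroup falls under one of the
  two kinds.\<close>

lemma comm_minimal_normal_elementary_abelian:
  assumes fin: "finite (carrier G)" and M: "minimal_normal G M"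
    and comm: "comm_group (G\<lparr>carrier := M\<rparr>)"
  shows "elementary_abelian (G\<lparr>carrier := M\<rparr>)"
proof -
  have Mn: "M \<lhd> G" using M by (simp add: minimal_normal_def)
  note car = normal_mem_carrier[OF Mn]
  have c: "x \<otimes> y = y \<otimes> x" if "x \<in> M" "y \<in> M" for x y
    using comm that comm_group_normal_iff[OF Mn] by blast
  have pow_M: "x [^] n \<in> M" if "x \<in> M" for x and n :: nat
    by (induction n) (use that one_in_normal[OF Mn] normal_m_closed[OF Mn] in auto)
  obtain x where x: "x \<in> M" "x \<noteq> \<one>"
    using M one_in_normal[OF Mn] by (auto simp: minimal_normal_def)
  have ox: "ord x \<noteq> 1" "ord x > 0"
    using x car ord_eq_1 ord_ge_1[OF fin] by (auto simp: Suc_le_eq)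
  obtain p where p: "prime p" "p dvd ord x" using prime_factor_nat[OF ox(1)] by blast
  \<comment> \<open>A nontrivial element of \<open>M\<close> killed by \<open>p\<close>, which shows
    that \<open>?P\<close> below is not trivial.\<close>
  define y where "y = x [^] (ord x div p)"
  have y: "y \<in> M" "y [^] p = \<one>"
    unfolding y_def using pow_M x car p by (auto simp: nat_pow_pow)
  have "\<not> ord x dvd ord x div p"
    using p ox by (metis dvd_div_eq_0_iff dvd_imp_le div_less_dividend not_less prime_gt_1_nat bot_nat_0.not_eq_extremum)
  then have "y \<noteq> \<one>" unfolding y_def using pow_eq_id x car by blast
  let ?P = "{z \<in> M. z [^] p = \<one>}"
  have "?P \<lhd> G"
  proof (rule normal_conj_actI)
    show "subgroup ?P G"
    proof (rule subgroupI)
      show "?P \<subseteq> carrier G" using car by blast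
      show "?P \<noteq> {}" using y by blast
      show "inv a \<in> ?P" if "a \<in> ?P" for a
        using that normal_inv_closed[OF Mn] car by (auto simp: nat_pow_inv)
      show "a \<otimes> b \<in> ?P" if "a \<in> ?P" "b \<in> ?P" for a b
        using that normal_m_closed[OF Mn] car c by (auto simp: pow_mult_distrib)
    qed
    show "conj_act G g z \<in> ?P" if g: "g \<in> carrier G" and z: "z \<in> ?P" for g z
    proof -
      have "conj_act G g z [^] n = conj_act G g (z [^] n)" for n :: nat
      proof (induction n)
        case 0
        show ?case using g by (simp add: conj_act_def)
      next
        case (Suc n)
        then show ?case using conj_act_mult[OF g, of "z [^] n" z] z car by simp
      qed
      then show ?thesis using conj_act_normal[OF Mn g] z g by (simp add: conj_act_def)
    qed
  qed
  then have "?P = {\<one>} \<or> ?P = M" using M by (simp add: minimal_normal_def)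
  then have "?P = M" using y \<open>y \<noteq> \<one>\<close> by blast
  then have "\<forall>z\<in>M. z [^]\<^bsub>G\<lparr>carrier := M\<rparr>\<^esub> p = \<one>"
    by (auto simp flip: nat_pow_consistent)
  then show ?thesis using comm p(1) by (auto simp: elementary_abelian_def)
qed

end

section \<open>The Moebius function below the socle\<close>

context group
begin

lemma subgroups_iso_refl: "subgroups_iso G A A"
  unfolding subgroups_iso_def equivariant_iso_def by (rule bexI[OF _ iso_set_refl]) simp

lemma subgroups_iso_comm_group:
  assumes "subgroups_iso G M A" "M \<lhd> G" "A \<lhd> G" "comm_group (G\<lparr>carrier := A\<rparr>)"
  shows "comm_group (G\<lparr>carrier := M\<rparr>)"
proof -
  obtain f where f: "f \<in> iso (G\<lparr>carrier := M\<rparr>) (G\<lparr>carrier := A\<rparr>)"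
    using assms(1) by (auto simp: subgroups_iso_def equivariant_iso_def)
  have inj: "inj_on f M" and fA: "\<And>x. x \<in> M \<Longrightarrow> f x \<in> A"
    and fm: "\<And>x y. x \<in> M \<Longrightarrow> y \<in> M \<Longrightarrow> f (x \<otimes> y) = f x \<otimes> f y"
    using f by (auto simp: iso_def bij_betw_def hom_def)
  have "x \<otimes> y = y \<otimes> x" if x: "x \<in> M" and y: "y \<in> M" for x y
  proof (rule inj_onD[OF inj])
    have "f x \<otimes> f y = f y \<otimes> f x"
      using assms(4) comm_group_normal_iff[OF assms(3)] fA x y by blast
    then show "f (x \<otimes> y) = f (y \<otimes> x)" using fm x y by simp
  qed (use normal_m_closed[OF assms(2)] x y in auto)
  then show ?thesis using comm_group_normal_iff[OF assms(2)] by blast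
qed

lemma card_normal_homs_iso:
  assumes "subgroups_iso G M A" "M \<lhd> G" "A \<lhd> G"
  shows "card (normal_homs G M B) = card (normal_homs G A B)"
  using assms acts_by_endos_normal by (intro card_equivariant_homs_iso) (auto simp: subgroups_iso_def)

text \<open>The trivial map and the identity differ. Hence a power of \<open>q i\<close> determines
  its exponent, and \<open>q i\<close> can be cancelled.\<close>

lemma card_normal_endos_ge_2:
  assumes fin: "finite (carrier G)" and A: "A \<lhd> G" "A \<noteq> {\<one>}"
  shows "card (normal_homs G A A) \<ge> 2"
proof -
  note act = acts_by_endos_normal[OF A(1)]
  obtain x where x: "x \<in> A" "x \<noteq> \<one>" using A one_in_normal[OF A(1)] by auto
  have "(\<lambda>x\<in>A. \<one>) \<in> normal_homs G A A"
    using equivariant_homs_trivial[OF act act] by simp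
  moreover have "(\<lambda>x\<in>A. x) \<in> normal_homs G A A"
    using equivariant_homsI[where f = "\<lambda>x. x" and s = "conj_act G" and Y = "G\<lparr>carrier := A\<rparr>", OF _ _ _ act]
    by simp
  moreover have "(\<lambda>x\<in>A. \<one>) \<noteq> (\<lambda>x\<in>A. x)" using x by (metis restrict_apply')
  moreover have "finite (normal_homs G A A)"
    using normal_subgroup_finite[OF fin A(1)] by (intro finite_equivariant_homs) auto
  ultimately have "card {\<lambda>x\<in>A. \<one>, \<lambda>x\<in>A. x} \<le> card (normal_homs G A A)"
    by (intro card_mono) auto
  then show ?thesis using \<open>(\<lambda>x\<in>A. \<one>) \<noteq> (\<lambda>x\<in>A. x)\<close> by simp
qed

lemma card_normal_homs_trivial:
  assumes "A \<lhd> G"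
  shows "card (normal_homs G {\<one>} A) = 1"
proof -
  have "f = (\<lambda>x\<in>{\<one>}. \<one>)" if "f \<in> normal_homs G {\<one>} A" for f
    using normal_homs_one[OF that one_is_normal assms] normal_homsD(1)[OF that]
    by (auto intro!: extensionalityI[of _ "{\<one>}"])
  moreover have "(\<lambda>x\<in>{\<one>}. \<one>) \<in> normal_homs G {\<one>} A"
    using equivariant_homs_trivial[OF acts_by_endos_normal[OF one_is_normal] acts_by_endos_normal[OF assms]]
    by simp
  ultimately have "normal_homs G {\<one>} A = {\<lambda>x\<in>{\<one>}. \<one>}" by blast
  then show ?thesis by simp
qed

lemma abelian_minimal_normalsD:
  assumes "A \<in> abelian_minimal_normals G"
  shows "minimal_normal G A" "A \<lhd> G" "A \<noteq> {\<one>}" "comm_group (G\<lparr>carrier := A\<rparr>)"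
  using assms by (auto simp: abelian_minimal_normals_def elementary_abelian_def minimal_normal_def)

text \<open>By Schur's lemma, since a non-Abelian group is not isomorphic to an Abelian one.
  Non-Abelian factors are therefore invisible to the homomorphism counts.\<close>

lemma card_normal_homs_nonabelian:
  assumes "S \<in> nonabelian_minimal_normals G" "A \<in> abelian_minimal_normals G"
  shows "card (normal_homs G S A) = 1"
proof (rule schur)
  show S: "minimal_normal G S" using assms(1) by (simp add: nonabelian_minimal_normals_def)
  show "minimal_normal G A" using abelian_minimal_normalsD[OF assms(2)] by blast
  show "\<not> subgroups_iso G S A"
    using subgroups_iso_comm_group abelian_minimal_normalsD[OF assms(2)] assms(1) S
    by (auto simp: nonabelian_minimal_normals_def minimal_normal_def)
qed

text \<open>Schur's lemma again: \<open>M\<close> is isomorphic to exactly one representative, so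
  there are nontrivial homomorphisms only to that one.\<close>

lemma card_normal_homs_representatives:
  assumes "\<forall>i\<in>I. A i \<in> abelian_minimal_normals G"
    and "\<forall>M\<in>abelian_minimal_normals G. \<exists>!i. i \<in> I \<and> subgroups_iso G M (A i)"
    and "M \<in> abelian_minimal_normals G" "i \<in> I" "subgroups_iso G M (A i)" "k \<in> I"
  shows "card (normal_homs G M (A k)) = (if k = i then card (normal_homs G (A k) (A k)) else 1)"
proof (cases "k = i")
  case True
  then show ?thesis
    using assms card_normal_homs_iso abelian_minimal_normalsD(2) by (metis (no_types))
next
  case False
  then have "\<not> subgroups_iso G M (A k)" using assms by blast
  then show ?thesis using False schur assms abelian_minimal_normalsD(1) by auto
qed

text \<open>Induction on the order of \<open>T\<close> with varying \<alpha>, removing a minimal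
  normal subgroup \<open>M\<close>. If \<open>M\<close> is Abelian, one exponent drops by 1 and the
  number of complements is a power of \<open>q i\<close>; otherwise the complement is unique and
  only the number of non-Abelian factors drops.\<close>

lemma mobius_below_socle:
  assumes fin: "finite (carrier G)" and I: "finite I"
    and A: "\<forall>i\<in>I. A i \<in> abelian_minimal_normals G"
    and uniq: "\<forall>M\<in>abelian_minimal_normals G. \<exists>!i. i \<in> I \<and> subgroups_iso G M (A i)"
    and q: "\<forall>i\<in>I. q i = card (normal_homs G (A i) (A i))"
    and T: "T \<lhd> G" "T \<subseteq> socle G" "\<forall>i\<in>I. card (normal_homs G T (A i)) = q i ^ \<alpha> i"
  shows "mobius (normal_lattice G) {\<one>} T =
    (-1) ^ card {N \<in> nonabelian_minimal_normals G. N \<subseteq> T} *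
    (\<Prod>i\<in>I. (-1) ^ \<alpha> i * int (q i) ^ (\<alpha> i choose 2))"
  using T
proof (induction "card T" arbitrary: T \<alpha> rule: less_induct)
  case less
  let ?m = "mobius (normal_lattice G) {\<one>}"
  let ?na = "\<lambda>T. {N \<in> nonabelian_minimal_normals G. N \<subseteq> T}"
  let ?p = "\<lambda>\<alpha> i. (-1) ^ \<alpha> i * int (q i) ^ (\<alpha> i choose 2)"
  note T = less.prems
  have An: "A i \<lhd> G" "comm_group (G\<lparr>carrier := A i\<rparr>)" "A i \<noteq> {\<one>}" if "i \<in> I" for i
    using abelian_minimal_normalsD A that by auto
  have q2: "q i \<ge> 2" if "i \<in> I" for i
    using card_normal_endos_ge_2[OF fin] An that q by simp
  have fin_na: "finite (?na N)" for N
    by (rule finite_subset[OF _ finite_normal_subgroups[OF fin, of "\<lambda>_. True"]])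
      (auto simp: nonabelian_minimal_normals_def minimal_normal_def)
  show ?case
  proof (cases "T = {\<one>}")
    case True
    \<comment> \<open>There is one homomorphism from the trivial group, and \<open>q i\<close> is at
      least 2.\<close>
    have "\<alpha> i = 0" if "i \<in> I" for i
    proof -
      have "q i ^ \<alpha> i = 1" using T(3) card_normal_homs_trivial An that True by simp
      then show ?thesis using q2[OF that] by simp
    qed
    then have prod: "(\<Prod>i\<in>I. ?p \<alpha> i) = 1" by (intro prod.neutral) (simp add: numeral_2_eq_2)
    have "N \<notin> ?na T" for N
      using True one_in_normal by (auto simp: nonabelian_minimal_normals_def minimal_normal_def)
    then have na: "?na T = {}" by blast
    show ?thesis
      unfolding na prod using mobius_normal_lattice_refl[OF fin one_is_normal] True by simp
  next
    case False
    obtain M where M: "minimal_normal G M" "M \<subseteq> T"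
      using minimal_normal_exists[OF fin T(1) False] by blast
    then have Mn: "M \<lhd> G" "M \<noteq> {\<one>}" by (auto simp: minimal_normal_def)
    obtain N\<^sub>0 where N0: "N\<^sub>0 \<in> complements M T"
      using complements_nonempty[OF fin Mn(1) T(1) M(2) T(2)] by blast
    have IH: "?m N = (-1) ^ card (?na N) * (\<Prod>i\<in>I. ?p \<beta> i)"
      if N: "N \<in> complements M T" and \<beta>: "\<forall>i\<in>I. card (normal_homs G N (A i)) = q i ^ \<beta> i" for N \<beta>
    proof (rule less.hyps)
      note NM = complementsD[OF N Mn(1)]
      have "N \<noteq> T" using NM(2) M(2) Mn by auto
      then show "card N < card T"
        using NM(3) normal_subgroup_finite[OF fin T(1)] by (intro psubset_card_mono) auto
      show "N \<lhd> G" "N \<subseteq> socle G" using NM T by auto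
    qed (fact \<beta>)
    have homs: "q i ^ \<alpha> i = card (normal_homs G M (A i)) * card (normal_homs G N (A i))"
      if "N \<in> complements M T" "i \<in> I" for N i
      using card_normal_homs_complement[OF that(1) Mn(1) T(1)] An that T(3) by simp
    have mT: "?m T = - (\<Sum>N\<in>complements M T. ?m N)"
      by (rule mobius_complements[OF fin M(1) T(1) M(2)])
    show ?thesis
    proof (cases "comm_group (G\<lparr>carrier := M\<rparr>)")
      case True
      then have Mab: "M \<in> abelian_minimal_normals G"
        using M(1) comm_minimal_normal_elementary_abelian[OF fin M(1)]
        by (simp add: abelian_minimal_normals_def)
      obtain i where i: "i \<in> I" "subgroups_iso G M (A i)" using uniq Mab by blast
      note hM = card_normal_homs_representatives[OF A uniq Mab i]
      have hN0: "q i ^ \<alpha> i = q i * card (normal_homs G N (A i))" if "N \<in> complements M T" for N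
        using homs[OF that i(1)] hM[OF i(1)] q i(1) by simp
      \<comment> \<open>The factor \<open>M\<close> contributes \<open>q i\<close> homomorphisms to
        \<open>A i\<close>, so the exponent cannot be 0.\<close>
      obtain b where b: "\<alpha> i = Suc b"
      proof (cases "\<alpha> i")
        case 0
        then show ?thesis using hN0[OF N0] q2[OF i(1)] by simp
      qed (rule that)
      let ?\<beta> = "\<alpha>(i := b)"
      have hN: "\<forall>k\<in>I. card (normal_homs G N (A k)) = q k ^ ?\<beta> k" if "N \<in> complements M T" for N
      proof
        fix k assume k: "k \<in> I"
        show "card (normal_homs G N (A k)) = q k ^ ?\<beta> k"
        proof (cases "k = i")
          case True
          then show ?thesis using hN0[OF that] b q2[OF i(1)] by simp
        next
          case False
          then show ?thesis using homs[OF that k] hM[OF k] by simp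
        qed
      qed
      have na: "?na N = ?na T" if N: "N \<in> complements M T" for N
      proof -
        have "M \<notin> nonabelian_minimal_normals G" using True by (simp add: nonabelian_minimal_normals_def)
        then show ?thesis
          using nonabelian_minimal_in_complement[OF M(1) N] complementsD(3)[OF N Mn(1)] by blast
      qed
      have "?m T = - (\<Sum>N\<in>complements M T. (-1) ^ card (?na T) * (\<Prod>k\<in>I. ?p ?\<beta> k))"
        unfolding mT using IH[OF _ hN] na by simp
      also have "\<dots> = - (int (card (complements M T)) * ((-1) ^ card (?na T) * (\<Prod>k\<in>I. ?p ?\<beta> k)))"
        by simp
      \<comment> \<open>This is the number of homomorphisms from the complement to
        \<open>A i\<close>, and there the exponent is already lowered to \<open>b\<close>.\<close>
      also have "card (complements M T) = q i ^ b"
        using card_complements_abelian[OF Mn(1) T(1) An(1,2)[OF i(1)] i(2) N0] hN[OF N0] i(1) by simp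
      also have "(\<Prod>k\<in>I. ?p ?\<beta> k) = ?p ?\<beta> i * (\<Prod>k\<in>I - {i}. ?p \<alpha> k)"
        using I i(1) by (simp add: prod.remove)
      \<comment> \<open>The minus sign raises the exponent of -1 from \<open>b\<close> to
        \<open>Suc b\<close>, and \<open>b + (b choose 2)\<close> equals
        \<open>Suc b choose 2\<close>.\<close>
      also have "- (int (q i ^ b) * ((-1) ^ card (?na T) * (?p ?\<beta> i * (\<Prod>k\<in>I - {i}. ?p \<alpha> k)))) =
          (-1) ^ card (?na T) * (?p \<alpha> i * (\<Prod>k\<in>I - {i}. ?p \<alpha> k))"
        using b by (simp add: numeral_2_eq_2 power_add)
      also have "?p \<alpha> i * (\<Prod>k\<in>I - {i}. ?p \<alpha> k) = (\<Prod>k\<in>I. ?p \<alpha> k)"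
        using I i(1) by (simp add: prod.remove)
      finally show ?thesis .
    next
      case False
      then have Mna: "M \<in> nonabelian_minimal_normals G"
        using M(1) by (simp add: nonabelian_minimal_normals_def)
      have C: "complements M T = {N\<^sub>0}"
        using complement_nonabelian_unique[OF M(1) False N0] N0 by blast
      note NM = complementsD[OF N0 Mn(1)]
      \<comment> \<open>A non-Abelian \<open>M\<close> has only the trivial map to each
        \<open>A k\<close>, so the exponents carry over unchanged.\<close>
      have hN: "\<forall>k\<in>I. card (normal_homs G N\<^sub>0 (A k)) = q k ^ \<alpha> k"
        using homs[OF N0] card_normal_homs_nonabelian[OF Mna] A by simp
      have "\<not> M \<subseteq> N\<^sub>0" using NM(2) Mn(2) by auto
      then have Mnot: "M \<notin> ?na N\<^sub>0" by simp
      have "?na T = insert M (?na N\<^sub>0)"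
        using nonabelian_minimal_in_complement[OF M(1) N0] NM(3) M(2) Mna by blast
      then have "card (?na T) = Suc (card (?na N\<^sub>0))" using Mnot fin_na by simp
      then show ?thesis using mT C IH[OF N0 hN] by simp
    qed
  qed
qed

section \<open>Counting homomorphisms out of the prescribed direct product\<close>

lemma power_act_eq: "power_act G m = product_act {1..m} (\<lambda>_. conj_act G)"
  by (simp add: power_act_def product_act_def fun_eq_iff)

lemma socle_type_act_eq:
  "socle_type_act G a n K =
    direct_act (product_act {1..a} (\<lambda>i. power_act G (n i))) (product_act K (\<lambda>_. conj_act G))"
  by (simp add: socle_type_act_def direct_act_def product_act_def fun_eq_iff)

lemma acts_by_endos_power:
  assumes "A \<lhd> G"
  shows "acts_by_endos G (power_group G A m) (power_act G m)"
  unfolding power_act_eq power_group_def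
  by (rule acts_by_endos_product) (rule acts_by_endos_normal[OF assms])

lemma acts_by_endos_powers:
  assumes "\<And>i. i \<in> {1..a} \<Longrightarrow> A i \<lhd> G"
  shows "acts_by_endos G (product_group {1..a} (\<lambda>i. power_group G (A i) (n i)))
    (product_act {1..a} (\<lambda>i. power_act G (n i)))"
  by (rule acts_by_endos_product) (rule acts_by_endos_power[OF assms])

lemma acts_by_endos_normal_product:
  assumes "\<And>k. k \<in> K \<Longrightarrow> S k \<lhd> G"
  shows "acts_by_endos G (product_group K (\<lambda>k. G\<lparr>carrier := S k\<rparr>)) (product_act K (\<lambda>_. conj_act G))"
  by (rule acts_by_endos_product) (rule acts_by_endos_normal[OF assms])

lemma acts_by_endos_socle_type:
  assumes "\<And>i. i \<in> {1..a} \<Longrightarrow> A i \<lhd> G" "\<And>k. k \<in> K \<Longrightarrow> S k \<lhd> G"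
  shows "acts_by_endos G (socle_type G a A n K S) (socle_type_act G a n K)"
  unfolding socle_type_act_eq socle_type_def
  by (rule acts_by_endos_direct[OF acts_by_endos_powers[OF assms(1)] acts_by_endos_normal_product[OF assms(2)]])

text \<open>This reads the exponents \<open>n i\<close> off the isomorphism type, in the only form
  in which the induction below the socle uses them.\<close>

lemma card_equivariant_homs_socle_type:
  assumes A: "\<And>i. i \<in> {1..a} \<Longrightarrow> A i \<lhd> G" and S: "\<And>k. k \<in> K \<Longrightarrow> S k \<lhd> G"
    and K: "finite K" and B: "B \<lhd> G" "comm_group (G\<lparr>carrier := B\<rparr>)"
  shows "card (equivariant_homs G (socle_type G a A n K S) (socle_type_act G a n K)
      (G\<lparr>carrier := B\<rparr>) (conj_act G)) =
    (\<Prod>i=1..a. card (normal_homs G (A i) B) ^ n i) * (\<Prod>k\<in>K. card (normal_homs G (S k) B))"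
proof -
  note aB = acts_by_endos_normal[OF B(1)]
  have a1: "acts_by_endos G (product_group {1..a} (\<lambda>i. power_group G (A i) (n i)))
      (product_act {1..a} (\<lambda>i. power_act G (n i)))"
    by (rule acts_by_endos_powers[OF A])
  have a2: "acts_by_endos G (product_group K (\<lambda>k. G\<lparr>carrier := S k\<rparr>)) (product_act K (\<lambda>_. conj_act G))"
    by (rule acts_by_endos_normal_product[OF S])
  have "card (equivariant_homs G (power_group G (A i) (n i)) (power_act G (n i))
      (G\<lparr>carrier := B\<rparr>) (conj_act G)) = card (normal_homs G (A i) B) ^ n i" if "i \<in> {1..a}" for i
    unfolding power_act_eq power_group_def
    by (subst card_equivariant_homs_product[OF _ _ aB B(2)])
      (simp_all add: acts_by_endos_normal[OF A[OF that]])
  then have "card (equivariant_homs G (product_group {1..a} (\<lambda>i. power_group G (A i) (n i)))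
      (product_act {1..a} (\<lambda>i. power_act G (n i))) (G\<lparr>carrier := B\<rparr>) (conj_act G)) =
      (\<Prod>i=1..a. card (normal_homs G (A i) B) ^ n i)"
    by (subst card_equivariant_homs_product[OF finite_atLeastAtMost acts_by_endos_power[OF A] aB B(2)]) auto
  moreover have "card (equivariant_homs G (product_group K (\<lambda>k. G\<lparr>carrier := S k\<rparr>))
      (product_act K (\<lambda>_. conj_act G)) (G\<lparr>carrier := B\<rparr>) (conj_act G)) =
      (\<Prod>k\<in>K. card (normal_homs G (S k) B))"
    by (rule card_equivariant_homs_product[OF K acts_by_endos_normal[OF S] aB B(2)])
  ultimately show ?thesis
    unfolding socle_type_act_eq socle_type_def
      card_equivariant_homs_direct[OF a1 a2 aB B(2)]
    by simp
qed

end

theorem theorem2: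
  fixes G :: "('g, 'm) monoid_scheme" and H T :: "'g set"
  assumes "group G" and "finite (carrier G)"
    and "H \<lhd> G" and "T \<lhd> G" and "H \<subseteq> T"
  shows "let Q = G Mod H; T' = carrier (G\<lparr>carrier := T\<rparr> Mod H) in
    (\<not> T' \<subseteq> socle Q \<longrightarrow> mobius (normal_lattice G) H T = 0) \<and>
    (\<forall>(a::nat) (b::nat) (c::nat) (A :: nat \<Rightarrow> 'g set set) (S :: nat \<Rightarrow> 'g set set)
        (d :: nat \<Rightarrow> nat) (\<alpha> :: nat \<Rightarrow> nat) (j :: nat \<Rightarrow> nat) (q :: nat \<Rightarrow> nat).
      (\<forall>i\<in>{1..a}. A i \<in> abelian_minimal_normals Q) \<longrightarrow>
      (\<forall>M\<in>abelian_minimal_normals Q. \<exists>!i. i \<in> {1..a} \<and> subgroups_iso Q M (A i)) \<longrightarrow>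
      bij_betw S {a + 1..a + b} (nonabelian_minimal_normals Q) \<longrightarrow>
      (\<forall>i\<in>{1..a}. equivariant_iso Q
          (Q\<lparr>carrier := isotypic Q (A i)\<rparr>) (conj_act Q)
          (power_group Q (A i) (d i)) (power_act Q (d i))) \<longrightarrow>
      equivariant_iso Q
        (Q\<lparr>carrier := socle Q\<rparr>) (conj_act Q)
        (socle_type Q a A d {a + 1..a + b} S) (socle_type_act Q a d {a + 1..a + b}) \<longrightarrow>
      (\<forall>i\<in>{1..a}. q i = card (equivariant_endos Q (A i))) \<longrightarrow>
      T' \<subseteq> socle Q \<longrightarrow>
      inj_on j {1..c} \<longrightarrow>
      j ` {1..c} \<subseteq> {a + 1..a + b} \<longrightarrow>
      (\<lambda>k. S (j k)) ` {1..c} = {N \<in> nonabelian_minimal_normals Q. N \<subseteq> T'} \<longrightarrow>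
      equivariant_iso Q
        (Q\<lparr>carrier := T'\<rparr>) (conj_act Q)
        (socle_type Q a A \<alpha> {1..c} (\<lambda>k. S (j k))) (socle_type_act Q a \<alpha> {1..c}) \<longrightarrow>
      mobius (normal_lattice G) H T =
        (-1) ^ c * (\<Prod>i = 1..a. (-1) ^ \<alpha> i * int (q i) ^ (\<alpha> i choose 2)))"
proof -
  define Q where "Q = G Mod H"
  define T' where "T' = carrier (G\<lparr>carrier := T\<rparr> Mod H)"
  interpret Q: group Q unfolding Q_def by (rule normal.factorgroup_is_group[OF assms(3)])
  have fin: "finite (carrier Q)" using assms(2) by (simp add: Q_def carrier_FactGroup)
  have T': "T' \<lhd> Q"
    unfolding T'_def Q_def using group.normality_factorization[OF assms(1,3,5,4)]
    by (simp add: FactGroup_def)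
  have mob: "mobius (normal_lattice G) H T = mobius (normal_lattice Q) {\<one>\<^bsub>Q\<^esub>} T'"
    unfolding Q_def T'_def by (rule mobius_quotient[OF assms(2-5)])
  have main: "mobius (normal_lattice Q) {\<one>\<^bsub>Q\<^esub>} T' =
      (-1) ^ c * (\<Prod>i = 1..a. (-1) ^ \<alpha> i * int (q i) ^ (\<alpha> i choose 2))"
    if A: "\<forall>i\<in>{1..a}. A i \<in> abelian_minimal_normals Q"
      and uniq: "\<forall>M\<in>abelian_minimal_normals Q. \<exists>!i. i \<in> {1..a} \<and> subgroups_iso Q M (A i)"
      and S: "bij_betw S {a + 1..a + b} (nonabelian_minimal_normals Q)"
      and q: "\<forall>i\<in>{1..a}. q i = card (equivariant_endos Q (A i))"
      and sub: "T' \<subseteq> socle Q"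
      and j: "inj_on j {1..c}" "j ` {1..c} \<subseteq> {a + 1..a + b}"
      and Sj: "(\<lambda>k. S (j k)) ` {1..c} = {N \<in> nonabelian_minimal_normals Q. N \<subseteq> T'}"
      and iso: "equivariant_iso Q (Q\<lparr>carrier := T'\<rparr>) (conj_act Q)
        (socle_type Q a A \<alpha> {1..c} (\<lambda>k. S (j k))) (socle_type_act Q a \<alpha> {1..c})"
    for a b c :: nat and A S :: "nat \<Rightarrow> 'g set set" and \<alpha> j q :: "nat \<Rightarrow> nat"
  proof -
    \<comment> \<open>Without repetitions among the \<open>S (j k)\<close>, the number
      \<open>c\<close> is the number of non-Abelian minimal normal subgroups inside
      \<open>T'\<close>.\<close>
    have "inj_on (S \<circ> j) {1..c}"
      using S j by (intro comp_inj_on) (auto simp: bij_betw_def intro: inj_on_subset)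
    then have card: "card {N \<in> nonabelian_minimal_normals Q. N \<subseteq> T'} = c"
      using card_image[of "\<lambda>k. S (j k)" "{1..c}"] unfolding Sj[symmetric] by (simp add: comp_def)
    have An: "A i \<lhd> Q" "comm_group (Q\<lparr>carrier := A i\<rparr>)" if "i \<in> {1..a}" for i
      using A that Q.abelian_minimal_normalsD by auto
    have Sna: "S (j k) \<in> nonabelian_minimal_normals Q" if "k \<in> {1..c}" for k
      using Sj that by blast
    then have Sn: "S (j k) \<lhd> Q" if "k \<in> {1..c}" for k
      using that by (auto simp: nonabelian_minimal_normals_def minimal_normal_def)
    have q': "\<forall>i\<in>{1..a}. q i = card (normal_homs Q (A i) (A i))"
      using q by (simp add: equivariant_endos_eq)
    have "card (normal_homs Q T' (A i)) = q i ^ \<alpha> i" if i: "i \<in> {1..a}" for i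
    proof -
      \<comment> \<open>The given isomorphism moves the count to the external product, where it
        splits over the factors; those not isomorphic to \<open>A i\<close> contribute 1.\<close>
      have "card (normal_homs Q T' (A i)) =
          card (equivariant_homs Q (socle_type Q a A \<alpha> {1..c} (\<lambda>k. S (j k))) (socle_type_act Q a \<alpha> {1..c})
            (Q\<lparr>carrier := A i\<rparr>) (conj_act Q))"
        by (rule card_equivariant_homs_iso[OF iso Q.acts_by_endos_normal[OF T']]) (rule Q.acts_by_endos_socle_type[OF An(1) Sn])
      also have "\<dots> = (\<Prod>k=1..a. card (normal_homs Q (A k) (A i)) ^ \<alpha> k) *
          (\<Prod>k\<in>{1..c}. card (normal_homs Q (S (j k)) (A i)))"
        by (rule Q.card_equivariant_homs_socle_type) (use An Sn i in auto)
      also have "(\<Prod>k\<in>{1..c}. card (normal_homs Q (S (j k)) (A i))) = 1"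
        using Q.card_normal_homs_nonabelian[OF Sna] A i by (intro prod.neutral) auto
      also have "(\<Prod>k=1..a. card (normal_homs Q (A k) (A i)) ^ \<alpha> k) =
          (\<Prod>k=1..a. if k = i then q i ^ \<alpha> i else 1)"
      proof (rule prod.cong[OF refl])
        fix k assume k: "k \<in> {1..a}"
        show "card (normal_homs Q (A k) (A i)) ^ \<alpha> k = (if k = i then q i ^ \<alpha> i else 1)"
          using Q.card_normal_homs_representatives[OF A uniq _ k Q.subgroups_iso_refl i] A k q' by auto
      qed
      finally show ?thesis using i by simp
    qed
    then show ?thesis
      using Q.mobius_below_socle[OF fin finite_atLeastAtMost A uniq q' T' sub, of \<alpha>] unfolding card by blast
  qed
  show ?thesis
    unfolding Let_def Q_def[symmetric] T'_def[symmetric] mob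
  proof (intro conjI allI impI)
    assume "\<not> T' \<subseteq> socle Q"
    then show "mobius (normal_lattice Q) {\<one>\<^bsub>Q\<^esub>} T' = 0"
      by (rule Q.mobius_eq_0_outside_socle[OF fin T'])
  qed (rule main, assumption+)
qed

end
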